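(* Let $\mathbb{K}$ be an algebraically closed field of characteristic zero. For any positive integers $n$ and $d$ such that $2\leq d\leq n$ there exists a non-degenerate hypersurface of degree $d$ in $\mathbb{P}^n$ (over $\mathbb{K}$) that admits an induced additive action.
   Context: Ground field: $\mathbb{K}$ is algebraically closed of characteristic zero; all varieties are over $\mathbb{K}$, and hypersurfaces are irreducible closed subvarieties of codimension 1, given by an irreducible homogeneous polynomial, whose degree is the degree of the hypersurface. $\mathbb{G}_a^m$ denotes the algebraic group $(\mathbb{K},+)^m$, where $\mathbb{K}$ is identified with the affine line. Additive actions. An additive action on a variety $X$ is an effective regular action of $\mathbb{G}_a^m$ (for some $m$; necessarily $m=\dim X$) on $X$ with an open orbit. If $X\subseteq\mathbb{P}^n$ is a hypersurface, an additive action on $X$ is called induced if it can be extended to a regular action of $\mathbb{G}_a^m$ on the ambient space $\mathbb{P}^n$. Non-degenerate hypersurfaces. A hypersurface $X\subseteq\mathbb{P}^n$ given by $f(z_0,\dots,z_n)=0$ with $f$ homogeneous (the irreducible defining polynomial) is non-degenerate if there is no invertible linear change of variables after which $f$ depends on fewer than $n+1$ variables. Equivalently, $X$ is not a projective cone over a hypersurface $X_0\subseteq\mathbb{P}^k$ in a projective subspace $\mathbb{P}^k\subseteq\mathbb{P}^n$ for some $k<n$. *)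

theory Defs
  imports
    "HOL-Library.Poly_Mapping"
    "HOL-Computational_Algebra.Polynomial"
    "HOL-Analysis.Abstract_Topology"
    "Jordan_Normal_Form.Matrix"
begin

section \<open>Multivariate polynomials\<close>

text \<open>Monomials are finitely supported exponent functions; the product of polynomials is the
  convolution product of \<^typ>\<open>'b \<Rightarrow>\<^sub>0 'c\<close>.\<close>

type_synonym ('v, 'a) mpoly = "('v \<Rightarrow>\<^sub>0 nat) \<Rightarrow>\<^sub>0 'a"

definition vars :: "('v, 'a::zero) mpoly \<Rightarrow> 'v set" where
  "vars f = (\<Union>\<mu>\<in>Poly_Mapping.keys f. Poly_Mapping.keys \<mu>)"

definition eval_mpoly :: "('v \<Rightarrow> 'a) \<Rightarrow> ('v, 'a::comm_semiring_1) mpoly \<Rightarrow> 'a" where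
  "eval_mpoly \<rho> f =
     (\<Sum>\<mu>\<in>Poly_Mapping.keys f. Poly_Mapping.lookup f \<mu> *
        (\<Prod>i\<in>Poly_Mapping.keys \<mu>. \<rho> i ^ Poly_Mapping.lookup \<mu> i))"

definition subst_mpoly ::
    "('v \<Rightarrow> ('w, 'a) mpoly) \<Rightarrow> ('v, 'a::comm_semiring_1) mpoly \<Rightarrow> ('w, 'a) mpoly" where
  "subst_mpoly \<sigma> f =
     (\<Sum>\<mu>\<in>Poly_Mapping.keys f.
        Poly_Mapping.single 0 (Poly_Mapping.lookup f \<mu>) *
        (\<Prod>i\<in>Poly_Mapping.keys \<mu>. \<sigma> i ^ Poly_Mapping.lookup \<mu> i))"

definition var :: "'v \<Rightarrow> ('v, 'a::comm_semiring_1) mpoly" where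
  "var i = Poly_Mapping.single (Poly_Mapping.single i 1) 1"

definition is_form :: "nat \<Rightarrow> nat \<Rightarrow> (nat, 'a::zero) mpoly \<Rightarrow> bool" where
  "is_form n d f \<longleftrightarrow> vars f \<subseteq> {..n} \<and>
     (\<forall>\<mu>\<in>Poly_Mapping.keys f. (\<Sum>i\<le>n. Poly_Mapping.lookup \<mu> i) = d)"

text \<open>Elements of $K[t_0,\dots,t_{m-1}][z_0,\dots,z_n]$ that are homogeneous of degree \<open>e\<close> in the
  \<open>z\<close>-variables; \<^term>\<open>Inl i\<close> stands for $t_i$ and \<^term>\<open>Inr j\<close> for $z_j$.\<close>

definition is_relative_form :: "nat \<Rightarrow> nat \<Rightarrow> nat \<Rightarrow> (nat + nat, 'a::zero) mpoly \<Rightarrow> bool" where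
  "is_relative_form m n e g \<longleftrightarrow> vars g \<subseteq> Inl ` {..<m} \<union> Inr ` {..n} \<and>
     (\<forall>\<mu>\<in>Poly_Mapping.keys g. (\<Sum>j\<le>n. Poly_Mapping.lookup \<mu> (Inr j)) = e)"

definition eval_form :: "(nat, 'a::comm_semiring_1) mpoly \<Rightarrow> 'a vec \<Rightarrow> 'a" where
  "eval_form f v = eval_mpoly (\<lambda>i. v $ i) f"

definition eval_relative :: "(nat + nat, 'a::comm_semiring_1) mpoly \<Rightarrow> 'a vec \<Rightarrow> 'a vec \<Rightarrow> 'a" where
  "eval_relative g t v = eval_mpoly (case_sum (\<lambda>i. t $ i) (\<lambda>j. v $ j)) g"


section \<open>Projective space and Zariski topologies\<close>

text \<open>A point of projective space is the set of all its vectors of homogeneous coordinates.\<close>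

definition proj_point :: "'a::field vec \<Rightarrow> 'a vec set" where
  "proj_point v = {c \<cdot>\<^sub>v v | c. c \<noteq> 0}"

definition proj_space :: "nat \<Rightarrow> 'a::field vec set set" where
  "proj_space n = proj_point ` (carrier_vec (Suc n) - {0\<^sub>v (Suc n)})"

definition zariski_proj :: "nat \<Rightarrow> 'a::field vec set topology" where
  "zariski_proj n = topology_generated_by
     {{p \<in> proj_space n. \<forall>v\<in>p. eval_form g v \<noteq> 0} | g. \<exists>e. is_form n e g}"

text \<open>The Zariski topology of the product of affine \<open>m\<close>-space and projective \<open>n\<close>-space. In
  general it is finer than the product of the two Zariski topologies.\<close>

definition zariski_affine_proj :: "nat \<Rightarrow> nat \<Rightarrow> ('a::field vec \<times> 'a vec set) topology" where
  "zariski_affine_proj m n = topology_generated_by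
     {{(t, p). t \<in> carrier_vec m \<and> p \<in> proj_space n \<and> (\<forall>v\<in>p. eval_relative g t v \<noteq> 0)}
       | g. \<exists>e. is_relative_form m n e g}"

text \<open>Morphisms from the product of affine \<open>m\<close>-space and \<open>X\<close> to projective \<open>n\<close>-space: locally
  given by polynomials without common zero that are homogeneous of the same degree in the
  homogeneous coordinates.\<close>

definition regular_map ::
    "nat \<Rightarrow> nat \<Rightarrow> 'a::field vec set set \<Rightarrow> ('a vec \<Rightarrow> 'a vec set \<Rightarrow> 'a vec set) \<Rightarrow> bool" where
  "regular_map m n X \<phi> \<longleftrightarrow>
     (\<forall>t\<^sub>0\<in>carrier_vec m. \<forall>p\<^sub>0\<in>X. \<exists>U e F.
        openin (subtopology (zariski_affine_proj m n) (carrier_vec m \<times> X)) U \<and> (t\<^sub>0, p\<^sub>0) \<in> U \<and>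
        (\<forall>i\<le>n. is_relative_form m n e (F i)) \<and>
        (\<forall>(t, p)\<in>U. \<forall>v\<in>p.
           let w = vec (Suc n) (\<lambda>i. eval_relative (F i) t v)
           in w \<noteq> 0\<^sub>v (Suc n) \<and> \<phi> t p = proj_point w))"


section \<open>Additive actions\<close>

text \<open>The group $\mathbb{G}_a^m$ is \<^term>\<open>carrier_vec m\<close> under addition.\<close>

definition regular_action ::
    "nat \<Rightarrow> nat \<Rightarrow> 'a::field vec set set \<Rightarrow> ('a vec \<Rightarrow> 'a vec set \<Rightarrow> 'a vec set) \<Rightarrow> bool" where
  "regular_action m n X \<alpha> \<longleftrightarrow>
     (\<forall>t\<in>carrier_vec m. \<forall>p\<in>X. \<alpha> t p \<in> X) \<and>
     (\<forall>p\<in>X. \<alpha> (0\<^sub>v m) p = p) \<and>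
     (\<forall>s\<in>carrier_vec m. \<forall>t\<in>carrier_vec m. \<forall>p\<in>X. \<alpha> (s + t) p = \<alpha> s (\<alpha> t p)) \<and>
     regular_map m n X \<alpha>"

definition effective_action ::
    "nat \<Rightarrow> 'a::field vec set set \<Rightarrow> ('a vec \<Rightarrow> 'a vec set \<Rightarrow> 'a vec set) \<Rightarrow> bool" where
  "effective_action m X \<alpha> \<longleftrightarrow> (\<forall>t\<in>carrier_vec m. (\<forall>p\<in>X. \<alpha> t p = p) \<longrightarrow> t = 0\<^sub>v m)"

definition additive_action ::
    "nat \<Rightarrow> nat \<Rightarrow> 'a::field vec set set \<Rightarrow> ('a vec \<Rightarrow> 'a vec set \<Rightarrow> 'a vec set) \<Rightarrow> bool" where
  "additive_action m n X \<alpha> \<longleftrightarrow>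
     regular_action m n X \<alpha> \<and> effective_action m X \<alpha> \<and>
     (\<exists>p\<in>X. openin (subtopology (zariski_proj n) X) ((\<lambda>t. \<alpha> t p) ` carrier_vec m))"

definition induced_additive_action ::
    "nat \<Rightarrow> nat \<Rightarrow> 'a::field vec set set \<Rightarrow> ('a vec \<Rightarrow> 'a vec set \<Rightarrow> 'a vec set) \<Rightarrow> bool" where
  "induced_additive_action m n X \<alpha> \<longleftrightarrow>
     additive_action m n X \<alpha> \<and>
     (\<exists>\<beta>. regular_action m n (proj_space n) \<beta> \<and> (\<forall>t\<in>carrier_vec m. \<forall>p\<in>X. \<beta> t p = \<alpha> t p))"

definition admits_induced_additive_action :: "nat \<Rightarrow> 'a::field vec set set \<Rightarrow> bool" where
  "admits_induced_additive_action n X \<longleftrightarrow> (\<exists>m \<alpha>. induced_additive_action m n X \<alpha>)"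


section \<open>Hypersurfaces\<close>

text \<open>Irreducibility refers to the polynomial ring in all variables $z_0, z_1, \dots$; as a factor of
  a nonzero polynomial only involves variables of that polynomial, this agrees with irreducibility
  in $K[z_0,\dots,z_n]$.\<close>

definition hypersurface_eq :: "nat \<Rightarrow> nat \<Rightarrow> (nat, 'a::field) mpoly \<Rightarrow> bool" where
  "hypersurface_eq n d f \<longleftrightarrow> is_form n d f \<and> irreducible f"

definition hypersurface :: "nat \<Rightarrow> (nat, 'a::field) mpoly \<Rightarrow> 'a vec set set" where
  "hypersurface n f = {p \<in> proj_space n. \<forall>v\<in>p. eval_form f v = 0}"

definition linear_change :: "nat \<Rightarrow> 'a::field mat \<Rightarrow> (nat, 'a) mpoly \<Rightarrow> (nat, 'a) mpoly" where
  "linear_change n A =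
     subst_mpoly (\<lambda>i. \<Sum>j\<le>n. Poly_Mapping.single 0 (A $$ (i, j)) * var j)"

definition non_degenerate :: "nat \<Rightarrow> (nat, 'a::field) mpoly \<Rightarrow> bool" where
  "non_degenerate n f \<longleftrightarrow>
     \<not> (\<exists>A\<in>carrier_mat (Suc n) (Suc n). invertible_mat A \<and>
          card (vars (linear_change n A f)) < Suc n)"

end

theory Submission
  imports Defs "HOL-Computational_Algebra.Formal_Power_Series"
begin

text \<open>The hypersurface comes from a local algebra. Let $A$ be the algebra with basis
  $1, x, \dots, x^d, y_{d+1}, \dots, y_n$ and products $x^{d+1} = 0$, $x y_j = 0$,
  $y_i y_j = 0$ for $i \<noteq> j$ and $y_j^2 = -\frac{2}{d} x^d$. Its maximal ideal $\mathfrak m$ is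
  the direct sum of the socle $K x^d$ and the hyperplane $U$ spanned by $x, \dots, x^{d-1}$ and the
  $y_j$. The commutative unipotent group $\exp(U)$ has dimension $n - 1$ and acts on the projective
  space of $A$ by multiplication. Writing $\pi$ for the coefficient of $x^d$, an element
  $1 + a$ with $a \<in> \mathfrak m$ lies in $\exp(U)$ if and only if $\pi(\ln(1 + a)) = 0$. So the
  orbit of the unit is the part $z_0 \<noteq> 0$ of the hypersurface $X$ defined by the
  homogenised equation $d z_0^d \, \pi(\ln(z / z_0)) = 0$, and $X$ has the required action, induced
  from projective space. The invariance of the form (\<open>log_form_act\<close>) is the fact that
  the logarithm turns products into sums, and the orbit is computed in \<open>orbit_base\<close>.

  The form is made explicit through logarithmic derivatives. As $d$ times the coefficient of $x^d$
  in $\ln B$ is the coefficient of $x^{d-1}$ in $B'/B$, the contribution of the powers of $x$ obeys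
  a recursion with integer coefficients (\<open>log_deriv\<close>, in essence the Newton identities), while
  the $y_j$ contribute $z_0^{d-2} \sum_j z_j^2$; the factor $-\frac{2}{d}$ makes this coefficient
  equal to one. The group is parametrised by the logarithmic derivative of its elements as well:
  this differs from the parameter in $U$ by a linear isomorphism, as the characteristic is zero.

  The form equals $d z_0^{d-1} z_d + g$ with $g$ free of $z_d$, and $g$ is not divisible by $z_0$
  since it contains $\pm z_1^d$. In a factorisation one factor is therefore free of $z_d$ and
  divides both $z_0^{d-1} z_d$ and $g$, so that it is constant (\<open>irreducible_log_poly\<close>).

  If after a linear change of coordinates the form did not depend on all variables, it would be
  invariant under the translation by a nonzero vector $u$. The set of all such vectors is
  closed under differences and stable under $\exp(U)$, and its members satisfy $u_0 = 0$. Acting on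
  a nonzero member by a suitable group element and subtracting produces a nonzero multiple of $x^d$,
  unless the member already is one. But translation along $x^d$ changes the form, because of the term $d z_0^{d-1} z_d$. This is
  \<open>periods_trivial\<close>; it reflects that $A$ is a Gorenstein algebra, every nonzero ideal of
  which contains the socle.\<close>

section \<open>Sums over monomials\<close>

lemma sum_monomials:
  fixes f :: "'m \<Rightarrow>\<^sub>0 'a::comm_monoid_add"
  shows "(\<Sum>\<mu>\<in>Poly_Mapping.keys f. Poly_Mapping.single \<mu> (Poly_Mapping.lookup f \<mu>)) = f"
  by (rule poly_mapping_eqI)
     (auto simp: lookup_sum lookup_single when_def in_keys_iff)

text \<open>Evaluating a polynomial and regrouping it by the powers of one variable are both sums over
  its monomials of terms that are additive in the coefficient. For such sums multiplicativity
  on polynomials follows from multiplicativity on monomials by bilinearity.\<close>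

lemma sum_keys_mult:
  fixes f g :: "'m::comm_monoid_add \<Rightarrow>\<^sub>0 'a::comm_semiring_1"
    and h :: "'m \<Rightarrow> 'a \<Rightarrow> 'b::comm_semiring_1"
  assumes zero: "\<And>\<mu>. h \<mu> 0 = 0"
    and add: "\<And>\<mu> a b. h \<mu> (a + b) = h \<mu> a + h \<mu> b"
    and mult: "\<And>\<mu> \<nu> a b. h (\<mu> + \<nu>) (a * b) = h \<mu> a * h \<nu> b"
  shows "(\<Sum>\<mu>\<in>Poly_Mapping.keys (f * g). h \<mu> (Poly_Mapping.lookup (f * g) \<mu>)) =
    (\<Sum>\<mu>\<in>Poly_Mapping.keys f. h \<mu> (Poly_Mapping.lookup f \<mu>)) *
    (\<Sum>\<mu>\<in>Poly_Mapping.keys g. h \<mu> (Poly_Mapping.lookup g \<mu>))"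
proof -
  define H where "H p = (\<Sum>\<mu>\<in>Poly_Mapping.keys p. h \<mu> (Poly_Mapping.lookup p \<mu>))"
    for p :: "'m \<Rightarrow>\<^sub>0 'a"
  have H_add: "H (p + q) = H p + H q" for p q
    unfolding H_def by (rule setsum_keys_plus_distrib) (simp_all add: zero add)
  have H_0: "H 0 = 0"
    by (simp add: H_def)
  have H_sum: "H (sum p A) = (\<Sum>x\<in>A. H (p x))" if "finite A" for p and A :: "'m set"
    using that by induction (simp_all add: H_0 H_add)
  have H_single: "H (Poly_Mapping.single \<mu> a) = h \<mu> a" for \<mu> a
    by (simp add: H_def zero)
  have "f * g = (\<Sum>\<mu>\<in>Poly_Mapping.keys f. \<Sum>\<nu>\<in>Poly_Mapping.keys g.
      Poly_Mapping.single (\<mu> + \<nu>) (Poly_Mapping.lookup f \<mu> * Poly_Mapping.lookup g \<nu>))"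
    by (subst (1 2) sum_monomials[symmetric]) (simp add: sum_product mult_single)
  then have "H (f * g) = H f * H g"
    by (simp add: H_sum H_single mult sum_product) (simp add: H_def sum_product)
  then show ?thesis
    by (simp add: H_def)
qed

section \<open>Evaluation of polynomials\<close>

lemma monomial_value_superset:
  fixes \<rho> :: "'v \<Rightarrow> 'a::comm_semiring_1"
  assumes "finite S" "Poly_Mapping.keys \<mu> \<subseteq> S"
  shows "(\<Prod>i\<in>Poly_Mapping.keys \<mu>. \<rho> i ^ Poly_Mapping.lookup \<mu> i) =
    (\<Prod>i\<in>S. \<rho> i ^ Poly_Mapping.lookup \<mu> i)"
  by (rule prod.mono_neutral_left) (use assms in \<open>auto simp: in_keys_iff\<close>)

lemma eval_mpoly_add: "eval_mpoly \<rho> (f + g) = eval_mpoly \<rho> f + eval_mpoly \<rho> g"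
  unfolding eval_mpoly_def
  by (rule setsum_keys_plus_distrib) (simp_all add: distrib_right)

lemma eval_mpoly_mult:
  fixes \<rho> :: "'v \<Rightarrow> 'a::comm_semiring_1"
  shows "eval_mpoly \<rho> (f * g) = eval_mpoly \<rho> f * eval_mpoly \<rho> g"
  unfolding eval_mpoly_def
proof (rule sum_keys_mult)
  fix \<mu> \<nu> :: "'v \<Rightarrow>\<^sub>0 nat" and a b :: 'a
  let ?S = "Poly_Mapping.keys \<mu> \<union> Poly_Mapping.keys \<nu>"
  have "Poly_Mapping.keys (\<mu> + \<nu>) \<subseteq> ?S"
    by (rule keys_add)
  then have "(\<Prod>i\<in>Poly_Mapping.keys (\<mu> + \<nu>). \<rho> i ^ Poly_Mapping.lookup (\<mu> + \<nu>) i) =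
      (\<Prod>i\<in>?S. \<rho> i ^ Poly_Mapping.lookup \<mu> i) * (\<Prod>i\<in>?S. \<rho> i ^ Poly_Mapping.lookup \<nu> i)"
    by (subst monomial_value_superset[of ?S]) (simp_all add: lookup_add power_add prod.distrib)
  also have "\<dots> = (\<Prod>i\<in>Poly_Mapping.keys \<mu>. \<rho> i ^ Poly_Mapping.lookup \<mu> i) *
      (\<Prod>i\<in>Poly_Mapping.keys \<nu>. \<rho> i ^ Poly_Mapping.lookup \<nu> i)"
    by (simp add: monomial_value_superset[of ?S, symmetric])
  finally show "a * b * (\<Prod>i\<in>Poly_Mapping.keys (\<mu> + \<nu>). \<rho> i ^ Poly_Mapping.lookup (\<mu> + \<nu>) i) =
      a * (\<Prod>i\<in>Poly_Mapping.keys \<mu>. \<rho> i ^ Poly_Mapping.lookup \<mu> i) *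
      (b * (\<Prod>i\<in>Poly_Mapping.keys \<nu>. \<rho> i ^ Poly_Mapping.lookup \<nu> i))"
    by (simp add: mult_ac)
qed (simp_all add: distrib_right)

lemma eval_mpoly_const: "eval_mpoly \<rho> (Poly_Mapping.single 0 c) = c"
  by (simp add: eval_mpoly_def)

lemma eval_mpoly_var: "eval_mpoly \<rho> (var i) = \<rho> i"
  by (simp add: eval_mpoly_def var_def)

lemma eval_mpoly_0: "eval_mpoly \<rho> 0 = 0"
  by (simp add: eval_mpoly_def)

lemma eval_mpoly_1: "eval_mpoly \<rho> 1 = 1"
  using eval_mpoly_const[of \<rho> 1] by simp

lemma eval_mpoly_diff:
  fixes f g :: "('v, 'a::comm_ring_1) mpoly"
  shows "eval_mpoly \<rho> (f - g) = eval_mpoly \<rho> f - eval_mpoly \<rho> g"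
  using eval_mpoly_add[of \<rho> "f - g" g] by (simp add: algebra_simps)

lemma eval_mpoly_sum: "eval_mpoly \<rho> (sum f A) = (\<Sum>x\<in>A. eval_mpoly \<rho> (f x))"
  by (induction A rule: infinite_finite_induct) (simp_all add: eval_mpoly_0 eval_mpoly_add)

lemma eval_mpoly_prod: "eval_mpoly \<rho> (prod f A) = (\<Prod>x\<in>A. eval_mpoly \<rho> (f x))"
  by (induction A rule: infinite_finite_induct) (simp_all add: eval_mpoly_1 eval_mpoly_mult)

lemma eval_mpoly_power: "eval_mpoly \<rho> (f ^ k) = eval_mpoly \<rho> f ^ k"
  by (induction k) (simp_all add: eval_mpoly_1 eval_mpoly_mult)

lemma eval_mpoly_of_nat: "eval_mpoly \<rho> (of_nat k) = of_nat k"
  using eval_mpoly_const[of \<rho> "of_nat k"] by simp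

lemmas eval_mpoly_hom = eval_mpoly_0 eval_mpoly_1 eval_mpoly_add eval_mpoly_diff eval_mpoly_mult
  eval_mpoly_power eval_mpoly_sum eval_mpoly_prod eval_mpoly_of_nat eval_mpoly_const eval_mpoly_var

lemma eval_mpoly_cong:
  assumes "\<And>i. i \<in> vars f \<Longrightarrow> \<rho> i = \<rho>' i"
  shows "eval_mpoly \<rho> f = eval_mpoly \<rho>' f"
  unfolding eval_mpoly_def
  by (intro sum.cong prod.cong arg_cong2[of _ _ _ _ "(*)"] arg_cong2[of _ _ _ _ "(^)"] refl assms)
     (auto simp: vars_def)

lemma eval_subst_mpoly: "eval_mpoly \<rho> (subst_mpoly \<sigma> f) = eval_mpoly (\<lambda>i. eval_mpoly \<rho> (\<sigma> i)) f"
  unfolding subst_mpoly_def eval_mpoly_hom by (simp add: eval_mpoly_def)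

lemma finite_vars: "finite (vars f)"
  by (simp add: vars_def)

section \<open>Degree in one variable\<close>

text \<open>The substitution $z_i \mapsto z_i X$. Keeping $z_i$ next to the power of $X$ that records its
  exponent makes this an injective ring homomorphism into polynomials over the same ring, so that
  no ring of polynomials in the remaining variables has to be introduced.\<close>

definition poly_in :: "'v \<Rightarrow> ('v, 'a::comm_semiring_1) mpoly \<Rightarrow> ('v, 'a) mpoly poly" where
  "poly_in i f = (\<Sum>\<mu>\<in>Poly_Mapping.keys f.
     monom (Poly_Mapping.single \<mu> (Poly_Mapping.lookup f \<mu>)) (Poly_Mapping.lookup \<mu> i))"

lemma lookup_coeff_poly_in:
  "Poly_Mapping.lookup (coeff (poly_in i f) k) \<mu> =
     (Poly_Mapping.lookup f \<mu> when Poly_Mapping.lookup \<mu> i = k)"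
proof -
  have "Poly_Mapping.lookup (coeff (poly_in i f) k) \<mu> =
      (\<Sum>\<nu>\<in>Poly_Mapping.keys f. if \<nu> = \<mu> then Poly_Mapping.lookup f \<mu> when Poly_Mapping.lookup \<mu> i = k else 0)"
    unfolding poly_in_def coeff_sum lookup_sum
    by (intro sum.cong refl) (auto simp: lookup_single when_def)
  then show ?thesis
    by (auto simp: in_keys_iff when_def)
qed

lemma poly_in_add: "poly_in i (f + g) = poly_in i f + poly_in i g"
  by (rule poly_eqI, rule poly_mapping_eqI)
     (simp add: lookup_coeff_poly_in lookup_add when_def)

lemma poly_in_mult: "poly_in i (f * g) = poly_in i f * poly_in i g"
  unfolding poly_in_def
  by (rule sum_keys_mult)
     (simp_all add: mult_monom mult_single lookup_add single_add add_monom)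

lemma poly_in_const:
  assumes "i \<notin> vars f"
  shows "poly_in i f = [:f:]"
proof (rule poly_eqI, rule poly_mapping_eqI)
  fix k \<mu>
  have "Poly_Mapping.lookup \<mu> i = 0" if "Poly_Mapping.lookup f \<mu> \<noteq> 0"
    using assms that by (auto simp: vars_def in_keys_iff)
  then show "Poly_Mapping.lookup (coeff (poly_in i f) k) \<mu> = Poly_Mapping.lookup (coeff [:f:] k) \<mu>"
    by (cases k; cases "Poly_Mapping.lookup f \<mu> = 0") (auto simp: lookup_coeff_poly_in when_def)
qed

lemma poly_in_eq_0_iff: "poly_in i f = 0 \<longleftrightarrow> f = 0"
proof
  assume 0: "poly_in i f = 0"
  show "f = 0"
  proof (rule poly_mapping_eqI)
    fix \<mu>
    show "Poly_Mapping.lookup f \<mu> = Poly_Mapping.lookup 0 \<mu>"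
      using lookup_coeff_poly_in[of i f "Poly_Mapping.lookup \<mu> i" \<mu>] 0 by simp
  qed
qed (simp add: poly_in_def)

lemma degree_poly_in_eq_0_iff: "Polynomial.degree (poly_in i f) = 0 \<longleftrightarrow> i \<notin> vars f"
proof
  assume deg: "Polynomial.degree (poly_in i f) = 0"
  show "i \<notin> vars f"
  proof
    assume "i \<in> vars f"
    then obtain \<mu> where \<mu>: "\<mu> \<in> Poly_Mapping.keys f" "Poly_Mapping.lookup \<mu> i \<noteq> 0"
      by (auto simp: vars_def in_keys_iff)
    then have "coeff (poly_in i f) (Poly_Mapping.lookup \<mu> i) \<noteq> 0"
      using lookup_coeff_poly_in[of i f "Poly_Mapping.lookup \<mu> i" \<mu>] by (auto simp: in_keys_iff)
    then show False
      using le_degree[of "poly_in i f" "Poly_Mapping.lookup \<mu> i"] deg \<mu> by simp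
  qed
qed (simp add: poly_in_const)

text \<open>The degree in $z_i$ is additive on products of nonzero polynomials, being a degree in one
  variable over an integral domain.\<close>

lemma vars_mult:
  fixes f g :: "(nat, 'a::idom) mpoly"
  assumes "f \<noteq> 0" "g \<noteq> 0"
  shows "vars (f * g) = vars f \<union> vars g"
proof -
  have "i \<notin> vars (f * g) \<longleftrightarrow> i \<notin> vars f \<and> i \<notin> vars g" for i
    using assms
    by (simp add: degree_poly_in_eq_0_iff[symmetric] poly_in_mult degree_mult_eq poly_in_eq_0_iff)
  then show ?thesis by blast
qed

lemma vars_empty_const:
  assumes "vars f = {}"
  shows "f = Poly_Mapping.single 0 (Poly_Mapping.lookup f 0)"
proof (rule poly_mapping_eqI)
  fix \<mu>
  have "\<mu> = 0" if "Poly_Mapping.lookup f \<mu> \<noteq> 0"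
  proof -
    have "Poly_Mapping.keys \<mu> = {}"
      using assms that by (auto simp: vars_def in_keys_iff)
    then show ?thesis by simp
  qed
  then show "Poly_Mapping.lookup f \<mu> =
      Poly_Mapping.lookup (Poly_Mapping.single 0 (Poly_Mapping.lookup f 0)) \<mu>"
    by (auto simp: lookup_single when_def)
qed

lemma vars_empty_unit:
  fixes f :: "('v, 'a::field) mpoly"
  assumes "vars f = {}" "f \<noteq> 0"
  shows "f dvd 1"
proof
  let ?c = "Poly_Mapping.lookup f 0"
  have "?c \<noteq> 0"
    using vars_empty_const[OF assms(1)] assms(2) by (metis single_zero)
  then show "1 = f * Poly_Mapping.single 0 (inverse ?c)"
    by (subst vars_empty_const[OF assms(1)]) (simp add: mult_single)
qed

text \<open>The order of vanishing at zero of a divisor of $c X^k$ equals its degree.\<close>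

lemma degree_0_of_mult_eq_monom:
  fixes p q :: "'a::idom poly"
  assumes "p * q = monom c k" "c \<noteq> 0" "coeff q 0 \<noteq> 0"
  shows "Polynomial.degree q = 0"
proof -
  have nz: "p * q \<noteq> 0"
    using assms(1,2) by simp
  then have "p \<noteq> 0" "q \<noteq> 0" by auto
  have "monom 1 k dvd p * q"
    unfolding assms(1) monom_1_dvd_iff' by simp
  then have "k \<le> Polynomial.order 0 (p * q)"
    using nz by (simp add: monom_1_dvd_iff)
  also have "\<dots> = Polynomial.order 0 p"
    using assms(3) by (simp add: order_mult[OF nz] order_0I poly_0_coeff_0)
  also have "\<dots> \<le> Polynomial.degree p"
    using \<open>p \<noteq> 0\<close> by (rule order_degree)
  finally show ?thesis
    using degree_mult_eq[OF \<open>p \<noteq> 0\<close> \<open>q \<noteq> 0\<close>] assms(1,2) by (simp add: degree_monom_eq)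
qed

notation fps_nth (infixl \<open>$.\<close> 75)

lemma fps_nth_Abs_fps_fun [simp]: "fps_nth (Abs_fps f) = f"
  by (rule ext) simp

declare fps_nth_inverse [simp]

section \<open>Logarithmic derivatives of power series\<close>

text \<open>The coefficients $q_k$ of $B'/B = \sum_k q_k x^k$ for the series $B = 1 + \sum_{i \<ge> 1} a_i x^i$:
  the recursion compares coefficients in $B' = B \cdot (B'/B)$. The constant coefficient of $B$ is
  one whatever the value of \<open>a 0\<close>, and no division occurs, so the same function serves
  for scalars and for polynomials.\<close>

fun log_deriv :: "(nat \<Rightarrow> 'a::comm_ring_1) \<Rightarrow> nat \<Rightarrow> 'a" where
  "log_deriv a k = of_nat (Suc k) * a (Suc k) - (\<Sum>i<k. a (k - i) * log_deriv a i)"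

declare log_deriv.simps [simp del]

lemma log_deriv_cong:
  assumes "\<And>i. 1 \<le> i \<Longrightarrow> i \<le> Suc k \<Longrightarrow> a i = b i"
  shows "log_deriv a k = log_deriv b k"
  using assms
proof (induction k rule: less_induct)
  case (less k)
  have "(\<Sum>i<k. a (k - i) * log_deriv a i) = (\<Sum>i<k. b (k - i) * log_deriv b i)"
  proof (intro sum.cong refl)
    fix i assume "i \<in> {..<k}"
    then show "a (k - i) * log_deriv a i = b (k - i) * log_deriv b i"
      using less.IH[of i] less.prems by auto
  qed
  then show ?case
    using less.prems by (simp add: log_deriv.simps[of _ k])
qed

lemma log_deriv_upd_top:
  "log_deriv (a(Suc k := a (Suc k) + x)) k = log_deriv a k + of_nat (Suc k) * x"
proof -
  have "(\<Sum>i<k. (a(Suc k := a (Suc k) + x)) (k - i) * log_deriv (a(Suc k := a (Suc k) + x)) i) =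
      (\<Sum>i<k. a (k - i) * log_deriv a i)"
    by (intro sum.cong arg_cong2[of _ _ _ _ "(*)"] log_deriv_cong) auto
  then show ?thesis
    by (simp add: log_deriv.simps[of _ k] algebra_simps)
qed

text \<open>The recursion has integer coefficients. Evaluating the form as a polynomial and computing it
  from the coordinates of a point therefore agree.\<close>

lemma log_deriv_hom:
  assumes "\<And>x y. \<phi> (x + y) = \<phi> x + \<phi> y" "\<And>x y. \<phi> (x * y) = \<phi> x * \<phi> y" "\<phi> 1 = 1"
  shows "\<phi> (log_deriv a k) = log_deriv (\<lambda>i. \<phi> (a i)) k"
proof -
  have zero: "\<phi> 0 = 0"
    using assms(1)[of 0 0] by simp
  have diff: "\<phi> (x - y) = \<phi> x - \<phi> y" for x y
    using assms(1)[of "x - y" y] by (simp add: algebra_simps)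
  have of_nat: "\<phi> (of_nat m) = of_nat m" for m
    by (induction m) (simp_all add: zero assms)
  have sum: "\<phi> (sum f A) = (\<Sum>x\<in>A. \<phi> (f x))" if "finite A" for f and A :: "nat set"
    using that by induction (simp_all add: zero assms)
  show ?thesis
  proof (induction k rule: less_induct)
    case (less k)
    then show ?case
      by (simp add: log_deriv.simps[of _ k] diff assms sum of_nat del: of_nat_Suc)
  qed
qed

lemma log_deriv_iff:
  fixes A Q :: "'a::comm_ring_1 fps"
  assumes "A $. 0 = 1"
  shows "fps_deriv A = A * Q \<longleftrightarrow> (\<forall>k. Q $. k = log_deriv (fps_nth A) k)"
proof -
  have coeff: "(A * Q) $. k = Q $. k + (\<Sum>i<k. A $. (k - i) * Q $. i)" for k
  proof -
    have "(A * Q) $. k = (\<Sum>i=0..k. Q $. i * A $. (k - i))"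
      by (simp add: fps_mult_nth mult.commute[of A])
    also have "{0..k} = insert k {..<k}" by auto
    finally show ?thesis
      using assms by (simp add: mult.commute)
  qed
  show ?thesis
  proof
    assume ode: "fps_deriv A = A * Q"
    have "Q $. k = log_deriv (fps_nth A) k" for k
    proof (induction k rule: less_induct)
      case (less k)
      have "of_nat (Suc k) * A $. Suc k = Q $. k + (\<Sum>i<k. A $. (k - i) * Q $. i)"
        using arg_cong[OF ode, of "\<lambda>F. F $. k"] by (simp add: coeff)
      also have "(\<Sum>i<k. A $. (k - i) * Q $. i) = (\<Sum>i<k. A $. (k - i) * log_deriv (fps_nth A) i)"
        using less.IH by simp
      finally show ?case
        by (simp add: log_deriv.simps[of _ k] del: of_nat_Suc)
    qed
    then show "\<forall>k. Q $. k = log_deriv (fps_nth A) k" by blast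
  next
    assume Q: "\<forall>k. Q $. k = log_deriv (fps_nth A) k"
    show "fps_deriv A = A * Q"
    proof (rule fps_ext)
      fix k
      show "fps_deriv A $. k = (A * Q) $. k"
        by (simp add: coeff Q log_deriv.simps[of _ k])
    qed
  qed
qed

text \<open>$(BC)' = BC \, (B'/B + C'/C)$.\<close>

lemma log_deriv_mult:
  fixes A B :: "'a::comm_ring_1 fps"
  assumes "A $. 0 = 1" "B $. 0 = 1"
  shows "log_deriv (fps_nth (A * B)) k = log_deriv (fps_nth A) k + log_deriv (fps_nth B) k"
proof -
  define P Q where "P = Abs_fps (log_deriv (fps_nth A))" and "Q = Abs_fps (log_deriv (fps_nth B))"
  have "fps_deriv A = A * P" "fps_deriv B = B * Q"
    by (simp_all add: log_deriv_iff assms P_def Q_def)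
  then have "fps_deriv (A * B) = (A * B) * (P + Q)"
    by (simp add: algebra_simps)
  then have "(P + Q) $. k = log_deriv (fps_nth (A * B)) k"
    using log_deriv_iff[of "A * B" "P + Q"] assms by simp
  then show ?thesis
    by (simp add: P_def Q_def)
qed

text \<open>In characteristic zero the recursion can be solved for the coefficients of the series, so
  that a series with constant coefficient one is determined by its logarithmic derivative. The
  addition theorem for \<open>expo\<close> and its surjectivity are derived from this.\<close>

lemma log_deriv_inject:
  fixes a b :: "nat \<Rightarrow> 'a::field_char_0"
  assumes "\<And>i. i < m \<Longrightarrow> log_deriv a i = log_deriv b i" "1 \<le> k" "k \<le> m"
  shows "a k = b k"
  using assms(2,3)
proof (induction k rule: less_induct)
  case (less k)
  obtain l where l: "k = Suc l"
    using less.prems by (cases k) auto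
  have "(\<Sum>i<l. a (l - i) * log_deriv a i) = (\<Sum>i<l. b (l - i) * log_deriv b i)"
    by (intro sum.cong arg_cong2[of _ _ _ _ "(*)"] less.IH assms(1)) (use less.prems l in auto)
  moreover have "log_deriv a l = log_deriv b l"
    using assms(1) less.prems l by simp
  ultimately have "of_nat (Suc l) * a k = of_nat (Suc l) * b k"
    by (simp add: log_deriv.simps[of _ l] l del: of_nat_Suc)
  then show ?case
    by (simp del: of_nat_Suc)
qed

text \<open>The series with constant coefficient one whose logarithmic derivative is
  $\sum_i u_i x^i$, that is, $\exp(\sum_i u_i x^{i+1} / (i+1))$.\<close>

fun expo :: "(nat \<Rightarrow> 'a::field_char_0) \<Rightarrow> nat \<Rightarrow> 'a" where
  "expo u 0 = 1"
| "expo u (Suc k) = (\<Sum>i\<le>k. u i * expo u (k - i)) / of_nat (Suc k)"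

declare expo.simps(2) [simp del]

lemma expo_cong:
  assumes "\<And>i. i < k \<Longrightarrow> u i = u' i"
  shows "expo u k = expo u' k"
  using assms
proof (induction k rule: less_induct)
  case (less k)
  show ?case
  proof (cases k)
    case (Suc l)
    have "(\<Sum>i\<le>l. u i * expo u (l - i)) = (\<Sum>i\<le>l. u' i * expo u' (l - i))"
      by (intro sum.cong arg_cong2[of _ _ _ _ "(*)"] less.IH less.prems) (auto simp: Suc)
    then show ?thesis
      by (simp add: Suc expo.simps(2))
  qed simp
qed

lemma fps_deriv_expo: "fps_deriv (Abs_fps (expo u)) = Abs_fps (expo u) * Abs_fps u"
proof (rule fps_ext)
  fix k
  have "of_nat (Suc k) * expo u (Suc k) = (\<Sum>i\<le>k. u i * expo u (k - i))"
    by (simp add: expo.simps(2) del: of_nat_Suc)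
  then show "fps_deriv (Abs_fps (expo u)) $. k = (Abs_fps (expo u) * Abs_fps u) $. k"
    by (simp add: mult.commute[of "Abs_fps (expo u)"] fps_mult_nth atLeast0AtMost del: of_nat_Suc)
qed

lemma log_deriv_expo: "log_deriv (expo u) k = u k"
  using log_deriv_iff[of "Abs_fps (expo u)" "Abs_fps u"] fps_deriv_expo[of u] by simp

lemma expo_add: "Abs_fps (expo (\<lambda>i. u i + u' i)) = Abs_fps (expo u) * Abs_fps (expo u')"
proof (rule fps_ext)
  fix k
  let ?P = "Abs_fps (expo u) * Abs_fps (expo u')"
  have "log_deriv (expo (\<lambda>i. u i + u' i)) i = log_deriv (fps_nth ?P) i" for i
    by (simp add: log_deriv_mult) (simp add: log_deriv_expo)
  then have "expo (\<lambda>i. u i + u' i) k = ?P $. k" if "k \<ge> 1"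
    by (rule log_deriv_inject[of k]) (use that in \<open>simp_all del: fps_nth_Abs_fps\<close>)
  then show "Abs_fps (expo (\<lambda>i. u i + u' i)) $. k = ?P $. k"
    by (cases k) simp_all
qed

lemma expo_0: "expo (\<lambda>_. 0) k = (if k = 0 then 1 else 0)"
  by (cases k) (simp_all add: expo.simps(2))

lemma expo_log_deriv:
  assumes "a 0 = 1" "\<And>i. i < k \<Longrightarrow> u i = log_deriv a i"
  shows "expo u k = a k"
proof (cases "k \<ge> 1")
  case True
  then show ?thesis
    using log_deriv_inject[of k "expo u" a k] assms by (simp add: log_deriv_expo)
next
  case False
  then have "k = 0" by simp
  then show ?thesis
    using assms by simp
qed

text \<open>The series is $\exp(x^i / i)$. Multiplication by it changes $x^{d-i}$ by a nonzero multiple of the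
  socle generator $x^d$ only.\<close>

lemma expo_single:
  assumes "i \<noteq> 0"
  shows "expo (\<lambda>l. if Suc l = i then 1 else 0) i = (1 / of_nat i :: 'a::field_char_0)"
    and "0 < k \<Longrightarrow> k < i \<Longrightarrow> expo (\<lambda>l. if Suc l = i then 1 else 0) k = (0 :: 'a)"
proof -
  let ?u = "\<lambda>l. if Suc l = i then 1 else 0 :: 'a"
  show "expo ?u i = 1 / of_nat i"
  proof (cases i)
    case (Suc m)
    have "(\<Sum>l\<le>m. ?u l * expo ?u (m - l)) = (\<Sum>l\<le>m. if l = m then 1 else 0)"
      by (intro sum.cong) (auto simp: Suc)
    also have "\<dots> = 1" by simp
    finally show ?thesis
      by (simp only: Suc expo.simps(2))
  qed (use assms in simp)
  have "expo ?u k = expo (\<lambda>_. 0) k" if "k < i"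
    by (rule expo_cong) (use that in auto)
  then show "0 < k \<Longrightarrow> k < i \<Longrightarrow> expo ?u k = 0"
    by (simp add: expo_0)
qed

section \<open>The logarithmic form\<close>

text \<open>This is $d z_0^d \, \pi(\ln(z / z_0))$.
  With $z(x) = \sum_{i \<le> d} z_i x^i$ the weights $z_0^{i-1}$ turn $z(x)$ into
  $z(z_0 x) / z_0 = 1 + \sum_{i \<ge> 1} z_0^{i-1} z_i x^i$. This clears the denominators of
  $\ln(z / z_0)$ and gives identities that also hold at $z_0 = 0$.\<close>

definition log_form :: "nat \<Rightarrow> nat \<Rightarrow> (nat \<Rightarrow> 'a::comm_ring_1) \<Rightarrow> 'a" where
  "log_form n d z = log_deriv (\<lambda>i. z 0 ^ (i - 1) * z i) (d - 1) +
     z 0 ^ (d - 2) * (\<Sum>j\<in>{d<..n}. z j ^ 2)"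

lemma log_form_cong:
  assumes "\<And>i. i \<le> n \<Longrightarrow> z i = z' i" "2 \<le> d" "d \<le> n"
  shows "log_form n d z = log_form n d z'"
  unfolding log_form_def
  by (intro arg_cong2[of _ _ _ _ "(+)"] arg_cong2[of _ _ _ _ "(*)"] log_deriv_cong sum.cong)
     (use assms in auto)

lemma log_form_hom:
  assumes "\<And>x y. \<phi> (x + y) = \<phi> x + \<phi> y" "\<And>x y. \<phi> (x * y) = \<phi> x * \<phi> y" "\<phi> 1 = 1"
  shows "\<phi> (log_form n d z) = log_form n d (\<lambda>i. \<phi> (z i))"
proof -
  have zero: "\<phi> 0 = 0"
    using assms(1)[of 0 0] by simp
  have sum: "\<phi> (sum f A) = (\<Sum>x\<in>A. \<phi> (f x))" for f and A :: "nat set"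
    by (induction A rule: infinite_finite_induct) (simp_all add: zero assms)
  have power: "\<phi> (x ^ k) = \<phi> x ^ k" for x k
    by (induction k) (simp_all add: assms)
  show ?thesis
    unfolding log_form_def by (simp add: assms log_deriv_hom[of \<phi>] sum power)
qed

text \<open>The coordinate $z_d$ enters only through the top term of the recursion, with coefficient
  $d z_0^{d-1}$.\<close>

lemma log_form_upd:
  assumes "2 \<le> d"
  shows "log_form n d (z(d := z d + x)) = log_form n d z + of_nat d * z 0 ^ (d - 1) * x"
proof -
  have d: "d = Suc (d - 1)" using assms by simp
  have squares: "(\<Sum>j\<in>{d<..n}. (z(d := z d + x)) j ^ 2) = (\<Sum>j\<in>{d<..n}. z j ^ 2)"
    by (intro sum.cong) auto
  have "log_deriv (\<lambda>i. (z(d := z d + x)) 0 ^ (i - 1) * (z(d := z d + x)) i) (d - 1) =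
      log_deriv ((\<lambda>i. z 0 ^ (i - 1) * z i)
        (Suc (d - 1) := z 0 ^ (Suc (d - 1) - 1) * z (Suc (d - 1)) + z 0 ^ (d - 1) * x)) (d - 1)"
    by (rule log_deriv_cong) (use d assms in \<open>auto simp: algebra_simps\<close>)
  also have "\<dots> = log_deriv (\<lambda>i. z 0 ^ (i - 1) * z i) (d - 1) + of_nat d * (z 0 ^ (d - 1) * x)"
    using log_deriv_upd_top[of "\<lambda>i. z 0 ^ (i - 1) * z i" "d - 1"] d by simp
  finally show ?thesis
    using assms by (simp add: log_form_def squares mult.assoc del: fun_upd_apply)
      (simp add: mult.assoc)
qed

section \<open>The unipotent action on coordinates\<close>

text \<open>The coefficient of $x^{d-1}$ in the logarithmic derivative is zero, which means that the
  logarithm of the series has no component along the socle $x^d$.\<close>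

definition exp_series :: "nat \<Rightarrow> (nat \<Rightarrow> 'a::field_char_0) \<Rightarrow> 'a fps" where
  "exp_series d t = Abs_fps (expo (\<lambda>i. if i < d - 1 then t i else 0))"

text \<open>Multiplication in $A$ by the exponential of the element of $U$ with parameter \<open>t\<close>: the
  entries $t_0, \dots, t_{d-2}$ give the component in $K[x]$ through its logarithmic derivative, and
  $t_{j-2}$ is the coefficient of $y_j$. The exponential of $\sum_j r_j y_j$ is
  $1 + \sum_j r_j y_j - \frac{1}{d} \sum_j r_j^2 x^d$, which explains the correction of
  the coordinate $d$.\<close>

definition act :: "nat \<Rightarrow> nat \<Rightarrow> (nat \<Rightarrow> 'a::field_char_0) \<Rightarrow> (nat \<Rightarrow> 'a) \<Rightarrow> nat \<Rightarrow> 'a" where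
  "act n d t v k =
     (if k < d then (Abs_fps v * exp_series d t) $. k
      else if k = d then (Abs_fps v * exp_series d t) $. d -
        (\<Sum>j\<in>{d<..n}. v 0 * t (j - 2) ^ 2 + 2 * t (j - 2) * v j) / of_nat d
      else v k + v 0 * t (k - 2))"

lemma exp_series_0 [simp]: "exp_series d t $. 0 = 1"
  by (simp add: exp_series_def)

lemma exp_series_add: "exp_series d (\<lambda>i. s i + t i) = exp_series d t * exp_series d s"
proof -
  have "(\<lambda>i. if i < d - 1 then s i + t i else 0) =
      (\<lambda>i. (if i < d - 1 then t i else 0) + (if i < d - 1 then s i else 0))"
    by (auto simp: algebra_simps)
  then show ?thesis
    by (simp add: exp_series_def expo_add)
qed

lemma exp_series_zero: "exp_series d (\<lambda>_. 0) = 1"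
  by (rule fps_ext) (simp add: exp_series_def expo_0)

lemma fps_mult_nth_cong:
  assumes "\<And>i. i \<le> k \<Longrightarrow> v i = w i"
  shows "(Abs_fps v * e) $. k = (Abs_fps w * e) $. k"
  by (simp add: fps_mult_nth assms)

lemma act_0_coord: "2 \<le> d \<Longrightarrow> act n d t v 0 = v 0"
  by (simp add: act_def)

lemma act_linear: "act n d t (\<lambda>i. c * v i + w i) k = c * act n d t v k + act n d t w k"
proof -
  have "Abs_fps (\<lambda>i. c * v i + w i) = fps_const c * Abs_fps v + Abs_fps w"
    by (rule fps_ext) simp
  then have "(Abs_fps (\<lambda>i. c * v i + w i) * e) $. l = c * (Abs_fps v * e) $. l + (Abs_fps w * e) $. l"
    for e l
    by (simp add: distrib_right mult.assoc)
  moreover have "(\<Sum>j\<in>{d<..n}. (c * v 0 + w 0) * t (j - 2) ^ 2 + 2 * t (j - 2) * (c * v j + w j)) =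
      c * (\<Sum>j\<in>{d<..n}. v 0 * t (j - 2) ^ 2 + 2 * t (j - 2) * v j) +
      (\<Sum>j\<in>{d<..n}. w 0 * t (j - 2) ^ 2 + 2 * t (j - 2) * w j)"
    unfolding sum_distrib_left sum.distrib[symmetric]
    by (intro sum.cong refl) (simp add: algebra_simps)
  ultimately show ?thesis
    by (simp add: act_def right_diff_distrib distrib_left distrib_right mult.assoc add_divide_distrib)
qed

lemma act_zero: "act n d (\<lambda>_. 0) v k = v k"
  by (simp add: act_def exp_series_zero)

text \<open>The correction of the coordinate $d$ is quadratic in the parameters. Its mixed terms come from the
  coordinates of index greater than $d$, which the first factor has already moved.\<close>

lemma act_add:
  assumes "2 \<le> d"
  shows "act n d (\<lambda>i. s i + t i) v k = act n d s (act n d t v) k"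
proof -
  let ?w = "act n d t v" and ?V = "Abs_fps v * exp_series d t"
  let ?q = "\<lambda>j. v 0 * t (j - 2) ^ 2 + 2 * t (j - 2) * v j"
  have low: "(Abs_fps ?w * exp_series d s) $. l = (?V * exp_series d s) $. l" if "l < d" for l
    using that fps_mult_nth_cong[of l ?w "fps_nth ?V"] by (simp add: act_def)
  have top: "(Abs_fps ?w * exp_series d s) $. d = (?V * exp_series d s) $. d - sum ?q {d<..n} / of_nat d"
  proof -
    have split: "(F * exp_series d s) $. d = (\<Sum>i<d. F $. i * exp_series d s $. (d - i)) + F $. d" for F
    proof -
      have "{0..d} = insert d {..<d}" by auto
      then show ?thesis by (simp add: fps_mult_nth add.commute)
    qed
    show ?thesis
      unfolding split by (simp add: act_def)
  qed
  have w0: "?w 0 = v 0"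
    using assms by (rule act_0_coord)
  have wj: "?w j = v j + v 0 * t (j - 2)" if "d < j" for j
    using that by (simp add: act_def)
  consider "k < d" | "k = d" | "k > d" by linarith
  then show ?thesis
  proof cases
    case 1
    then show ?thesis
      using low by (simp add: act_def[of n d "\<lambda>i. s i + t i"] act_def[of n d s] exp_series_add mult.assoc)
  next
    case 2
    have "(\<Sum>j\<in>{d<..n}. v 0 * (s (j - 2) + t (j - 2)) ^ 2 + 2 * (s (j - 2) + t (j - 2)) * v j) =
        sum ?q {d<..n} + (\<Sum>j\<in>{d<..n}. ?w 0 * s (j - 2) ^ 2 + 2 * s (j - 2) * ?w j)"
      unfolding sum.distrib[symmetric]
      by (intro sum.cong refl) (simp add: w0 wj power2_eq_square algebra_simps)
    then show ?thesis
      using top 2 by (simp add: act_def[of n d "\<lambda>i. s i + t i"] act_def[of n d s] exp_series_add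
          mult.assoc diff_divide_distrib add_divide_distrib)
  next
    case 3
    then show ?thesis
      using w0 wj by (simp add: act_def[of n d "\<lambda>i. s i + t i"] act_def[of n d s] algebra_simps)
  qed
qed

text \<open>If $y = v e$, then $y(v_0 x) / v_0$ is the product of $v(v_0 x) / v_0$ and $e(v_0 x)$. The
  identity of coefficients is verified without dividing by $v_0$, which may be zero.\<close>

lemma log_deriv_normalised_mult:
  fixes v :: "nat \<Rightarrow> 'a::field_char_0"
  assumes "\<And>i. u i = log_deriv e i" "e 0 = 1"
  shows "log_deriv (\<lambda>i. v 0 ^ (i - 1) * (Abs_fps v * Abs_fps e) $. i) k =
    log_deriv (\<lambda>i. v 0 ^ (i - 1) * v i) k + v 0 ^ Suc k * u k"
proof -
  let ?A = "Abs_fps (\<lambda>i. if i = 0 then 1 else v 0 ^ (i - 1) * v i)"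
  let ?B = "Abs_fps (\<lambda>i. v 0 ^ i * e i)"
  have prod: "v 0 ^ (i - 1) * (Abs_fps v * Abs_fps e) $. i = (?A * ?B) $. i" if "i \<ge> 1" for i
  proof -
    have "v 0 ^ (i - 1) * (v j * e (i - j)) = ?A $. j * ?B $. (i - j)" if "j \<le> i" for j
    proof (cases j)
      case 0
      have "v 0 ^ (i - 1) * v 0 = v 0 ^ i"
        using \<open>i \<ge> 1\<close> by (cases i) simp_all
      then show ?thesis by (simp add: 0 mult.assoc[symmetric])
    next
      case (Suc m)
      have "v 0 ^ (i - 1) = v 0 ^ m * v 0 ^ (i - j)"
        using that Suc by (simp add: power_add[symmetric])
      then show ?thesis by (simp add: Suc mult_ac)
    qed
    then show ?thesis
      unfolding fps_mult_nth sum_distrib_left by (intro sum.cong) simp_all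
  qed
  have "fps_deriv ?B = ?B * Abs_fps (\<lambda>i. v 0 ^ Suc i * u i)"
  proof (rule fps_ext)
    fix l
    have ode: "fps_deriv (Abs_fps e) = Abs_fps e * Abs_fps u"
      by (subst log_deriv_iff) (simp_all add: assms)
    have coeff: "of_nat (Suc l) * e (Suc l) = (\<Sum>i=0..l. e i * u (l - i))"
      using arg_cong[OF ode, of "\<lambda>F. F $. l"]
      by (simp add: fps_mult_nth del: of_nat_Suc)
    have "of_nat (Suc l) * (v 0 ^ Suc l * e (Suc l)) = v 0 ^ Suc l * (of_nat (Suc l) * e (Suc l))"
      by (rule mult.left_commute)
    also have "\<dots> = v 0 ^ Suc l * (\<Sum>i=0..l. e i * u (l - i))"
      by (simp only: coeff)
    also have "\<dots> = (\<Sum>i=0..l. v 0 ^ i * e i * (v 0 ^ Suc (l - i) * u (l - i)))"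
      unfolding sum_distrib_left
    proof (intro sum.cong refl)
      fix i assume "i \<in> {0..l}"
      then have "i + Suc (l - i) = Suc l" by simp
      then have "v 0 ^ Suc l = v 0 ^ i * v 0 ^ Suc (l - i)"
        by (simp only: power_add[symmetric])
      then show "v 0 ^ Suc l * (e i * u (l - i)) = v 0 ^ i * e i * (v 0 ^ Suc (l - i) * u (l - i))"
        by (simp add: mult_ac del: power_Suc)
    qed
    finally show "fps_deriv ?B $. l = (?B * Abs_fps (\<lambda>i. v 0 ^ Suc i * u i)) $. l"
      by (simp add: fps_mult_nth del: of_nat_Suc power_Suc)
  qed
  then have B: "log_deriv (fps_nth ?B) k = v 0 ^ Suc k * u k"
    using log_deriv_iff[of ?B "Abs_fps (\<lambda>i. v 0 ^ Suc i * u i)"] assms(2) by simp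
  have "log_deriv (\<lambda>i. v 0 ^ (i - 1) * (Abs_fps v * Abs_fps e) $. i) k = log_deriv (fps_nth (?A * ?B)) k"
    by (rule log_deriv_cong) (rule prod)
  also have "\<dots> = log_deriv (fps_nth ?A) k + log_deriv (fps_nth ?B) k"
    by (rule log_deriv_mult) (simp_all add: assms(2))
  also have "log_deriv (fps_nth ?A) k = log_deriv (\<lambda>i. v 0 ^ (i - 1) * v i) k"
    by (rule log_deriv_cong) simp
  finally show ?thesis
    using B by simp
qed

text \<open>The series part is unchanged because the logarithmic derivative of the group element has no
  coefficient at $x^{d-1}$. The change of the sum of squares is compensated by the correction of the
  coordinate $d$.\<close>

lemma log_form_act:
  assumes "2 \<le> d"
  shows "log_form n d (act n d t v) = log_form n d v"
proof -
  define y where "y = (\<lambda>i. if i \<le> d then (Abs_fps v * exp_series d t) $. i else v i + v 0 * t (i - 2))"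
  define q where "q = (\<Sum>j\<in>{d<..n}. v 0 * t (j - 2) ^ 2 + 2 * t (j - 2) * v j)"
  have y0: "y 0 = v 0" by (simp add: y_def)
  have pow: "v 0 ^ (d - 1) = v 0 ^ (d - 2) * v 0"
    using assms by (simp add: power_Suc2[symmetric] Suc_diff_Suc numeral_2_eq_2 del: power_Suc)
  have "log_deriv (\<lambda>i. y 0 ^ (i - 1) * y i) (d - 1) =
      log_deriv (\<lambda>i. v 0 ^ (i - 1) * (Abs_fps v * exp_series d t) $. i) (d - 1)"
    by (rule log_deriv_cong) (use assms in \<open>auto simp: y_def\<close>)
  also have "\<dots> = log_deriv (\<lambda>i. v 0 ^ (i - 1) * v i) (d - 1) +
      v 0 ^ Suc (d - 1) * (if d - 1 < d - 1 then t (d - 1) else 0)"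
    unfolding exp_series_def by (rule log_deriv_normalised_mult) (simp_all add: log_deriv_expo)
  finally have series: "log_deriv (\<lambda>i. y 0 ^ (i - 1) * y i) (d - 1) =
      log_deriv (\<lambda>i. v 0 ^ (i - 1) * v i) (d - 1)"
    by simp
  have "(\<Sum>j\<in>{d<..n}. y j ^ 2) = (\<Sum>j\<in>{d<..n}. v j ^ 2 + v 0 * (v 0 * t (j - 2) ^ 2 + 2 * t (j - 2) * v j))"
    by (intro sum.cong) (auto simp: y_def power2_eq_square algebra_simps)
  also have "\<dots> = (\<Sum>j\<in>{d<..n}. v j ^ 2) + v 0 * q"
    unfolding q_def sum_distrib_left by (rule sum.distrib)
  finally have squares: "(\<Sum>j\<in>{d<..n}. y j ^ 2) = (\<Sum>j\<in>{d<..n}. v j ^ 2) + v 0 * q" .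
  have "log_form n d y = log_form n d v + v 0 ^ (d - 1) * q"
    unfolding log_form_def series squares unfolding y0 pow by (simp add: distrib_left mult.assoc)
  moreover have "act n d t v = y(d := y d + - (q / of_nat d))"
    by (auto simp: act_def fun_eq_iff y_def q_def)
  ultimately show ?thesis
    using log_form_upd[OF assms, of n y "- (q / of_nat d)"] assms by (simp add: y0)
qed

definition base :: "nat \<Rightarrow> 'a::comm_ring_1" where
  "base i = (if i = 0 then 1 else 0)"

lemma base_simps [simp]: "base 0 = 1" "i \<noteq> 0 \<Longrightarrow> base i = 0"
  by (simp_all add: base_def)

lemma log_deriv_0: "log_deriv (\<lambda>_. 0) k = 0"
  by (simp add: log_deriv.simps[of _ k])

lemma log_form_base:
  assumes "2 \<le> d"
  shows "log_form n d base = 0"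
proof -
  have "log_deriv (\<lambda>i. base 0 ^ (i - 1) * base i) (d - 1) = log_deriv (\<lambda>_. 0) (d - 1)"
    by (rule log_deriv_cong) simp
  then show ?thesis
    by (simp add: log_form_def log_deriv_0)
qed

lemma act_base:
  fixes t :: "nat \<Rightarrow> 'a::field_char_0"
  assumes "2 \<le> d"
  shows "k < d \<Longrightarrow> act n d t base k = exp_series d t $. k"
    and "k > d \<Longrightarrow> act n d t base k = t (k - 2)"
proof -
  have "Abs_fps base = (1 :: 'a fps)"
    by (rule fps_ext) (simp add: base_def)
  then show "k < d \<Longrightarrow> act n d t base k = exp_series d t $. k"
    by (simp add: act_def)
  show "k > d \<Longrightarrow> act n d t base k = t (k - 2)"
    using assms by (simp add: act_def)
qed

text \<open>The logarithmic derivative of $v$ and its $y_j$-coordinates prescribe the parameter. This gives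
  all coordinates but the one of index $d$, which the vanishing of the form determines.\<close>

lemma orbit_base:
  fixes v :: "nat \<Rightarrow> 'a::field_char_0"
  assumes "2 \<le> d" "d \<le> n" "v 0 = 1" "log_form n d v = 0"
  obtains t where "\<And>k. k \<le> n \<Longrightarrow> act n d t base k = v k"
proof
  \<comment> \<open>The indices \<open>i + 2\<close> for \<open>d - 1 \<le> i\<close> are those of the coordinates along the $y_j$.\<close>
  define t where "t = (\<lambda>i. if i < d - 1 then log_deriv v i else v (i + 2))"
  define y where "y = act n d t base"
  have low: "y k = v k" if "k < d" for k
  proof -
    have "y k = expo (\<lambda>i. if i < d - 1 then t i else 0) k"
      using that assms(1) by (simp add: y_def act_base exp_series_def)
    also have "\<dots> = v k"
      by (rule expo_log_deriv) (use that assms(3) in \<open>auto simp: t_def\<close>)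
    finally show ?thesis .
  qed
  have high: "y k = v k" if "k > d" for k
  proof -
    have "\<not> k - 2 < d - 1" "k - 2 + 2 = k"
      using that assms(1) by auto
    then show ?thesis
      using that assms(1) by (simp add: y_def act_base t_def del: add_2_eq_Suc')
  qed
  \<comment> \<open>The coordinate of index \<open>d\<close> is determined by the others, as the form is linear in it.\<close>
  have "0 = log_form n d v"
    by (simp add: assms(4))
  also have "v = y(d := y d + (v d - y d))"
  proof
    fix k
    show "v k = (y(d := y d + (v d - y d))) k"
      by (cases k d rule: linorder_cases) (simp_all add: low high)
  qed
  also have "log_form n d \<dots> = log_form n d y + of_nat d * y 0 ^ (d - 1) * (v d - y d)"
    by (rule log_form_upd[OF assms(1)])
  also have "log_form n d y = 0"
    using assms(1) by (simp add: y_def log_form_act log_form_base)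
  also have "y 0 = 1"
    using low[of 0] assms(1,3) by simp
  finally have "y d = v d"
    using assms(1) by simp
  then show "act n d t base k = v k" if "k \<le> n" for k
    using low[of k] high[of k] by (cases k d rule: linorder_cases) (simp_all add: y_def)
qed

text \<open>The stabiliser of the unit is trivial; only its projective class has to be fixed for this, since
  the group preserves the coordinate $z_0$.\<close>

lemma act_base_eq_base:
  fixes t :: "nat \<Rightarrow> 'a::field_char_0"
  assumes "2 \<le> d" and fixed: "\<And>k. 1 \<le> k \<Longrightarrow> k \<le> n \<Longrightarrow> act n d t base k = 0"
    and "i < n - 1" "d \<le> n"
  shows "t i = 0"
proof (cases "i < d - 1")
  case True
  let ?u = "\<lambda>i. if i < d - 1 then t i else 0"
  have "log_deriv (expo ?u) i = log_deriv (\<lambda>_. 0) i"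
  proof (rule log_deriv_cong)
    fix k assume "1 \<le> k" "k \<le> Suc i"
    then show "expo ?u k = 0"
      using fixed[of k] True assms(1,4) act_base(1)[OF assms(1), of k n t] by (simp add: exp_series_def)
  qed
  then show ?thesis
    using True by (simp add: log_deriv_expo log_deriv_0)
next
  case False
  then show ?thesis
    using fixed[of "i + 2"] act_base(2)[OF assms(1), of "i + 2" n t] assms(3) by simp
qed

section \<open>Translations preserving the form\<close>

definition periods :: "nat \<Rightarrow> nat \<Rightarrow> (nat \<Rightarrow> 'a::field_char_0) set" where
  "periods n d = {u. \<forall>v. log_form n d (\<lambda>i. v i + u i) = log_form n d v}"

text \<open>The action is linear, invertible and preserves the form.\<close>

lemma periods_act:
  assumes "2 \<le> d" "u \<in> periods n d"
  shows "act n d t u \<in> periods n d"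
  unfolding periods_def
proof (intro CollectI allI)
  fix v
  define w where "w = act n d (\<lambda>i. - t i) v"
  have w: "act n d t w = v"
    using act_add[OF assms(1), of n t "\<lambda>i. - t i" v] by (simp add: w_def fun_eq_iff act_zero)
  have "(\<lambda>i. v i + act n d t u i) = act n d t (\<lambda>i. w i + u i)"
    using act_linear[of n d t 1 w u] w by (simp add: fun_eq_iff)
  then have "log_form n d (\<lambda>i. v i + act n d t u i) = log_form n d (\<lambda>i. w i + u i)"
    by (simp add: log_form_act assms(1))
  also have "\<dots> = log_form n d w"
    using assms(2) by (simp add: periods_def)
  also have "\<dots> = log_form n d v"
    using log_form_act[OF assms(1), of n t w] w by simp
  finally show "log_form n d (\<lambda>i. v i + act n d t u i) = log_form n d v" .
qed

lemma periods_diff: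
  assumes "u \<in> periods n d" "w \<in> periods n d"
  shows "(\<lambda>i. u i - w i) \<in> periods n d"
  unfolding periods_def
proof (intro CollectI allI)
  fix v
  have "log_form n d (\<lambda>i. x i + w i) = log_form n d x" for x
    using assms(2) by (simp add: periods_def)
  from this[of "\<lambda>i. v i + (u i - w i)", symmetric]
  have "log_form n d (\<lambda>i. v i + (u i - w i)) = log_form n d (\<lambda>i. (v i + (u i - w i)) + w i)" .
  also have "\<dots> = log_form n d v"
    using assms(1) by (simp add: periods_def)
  finally show "log_form n d (\<lambda>i. v i + (u i - w i)) = log_form n d v" .
qed

lemma periods_socle:
  assumes "2 \<le> d" "d \<le> n" "u \<in> periods n d" "\<And>k. k \<le> n \<Longrightarrow> k \<noteq> d \<Longrightarrow> u k = 0"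
  shows "u d = 0"
proof -
  have "log_form n d base = log_form n d (\<lambda>i. base i + u i)"
    using assms(3) by (simp add: periods_def)
  also have "\<dots> = log_form n d (base(d := base d + u d))"
    by (rule log_form_cong) (use assms in auto)
  also have "\<dots> = log_form n d base + of_nat d * u d"
    using log_form_upd[OF assms(1), of n base "u d"] by simp
  finally show ?thesis
    using assms(1) by simp
qed

text \<open>If a group element changes no coordinate of $u$ except possibly that of the socle, then the
  difference is a translation along the socle preserving the form, and hence zero.\<close>

lemma periods_move_to_socle:
  assumes "2 \<le> d" "d \<le> n" "u \<in> periods n d"
    and "\<And>k. k \<le> n \<Longrightarrow> k \<noteq> d \<Longrightarrow> act n d t u k = u k"
  shows "act n d t u d = u d"
proof -
  have "act n d t u d - u d = 0"
  proof (rule periods_socle[OF assms(1,2), of "\<lambda>i. act n d t u i - u i"])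
    show "(\<lambda>i. act n d t u i - u i) \<in> periods n d"
      using periods_act[OF assms(1,3)] assms(3) by (rule periods_diff)
  qed (simp add: assms(4))
  then show ?thesis by simp
qed

text \<open>The coefficient of $z_d$ in the form is $d z_0^{d-1}$. A translation preserving the form
  preserves this coefficient, in particular its zero at $z_0 = 0$.\<close>

lemma periods_0_coord:
  fixes u :: "nat \<Rightarrow> 'a::field_char_0"
  assumes "2 \<le> d" "u \<in> periods n d"
  shows "u 0 = 0"
proof -
  have period: "log_form n d (\<lambda>i. v i + u i) = log_form n d v" for v
    using assms(2) by (simp add: periods_def)
  let ?z = "(\<lambda>_. 0 :: 'a)(d := 1)"
  have "log_form n d u = log_form n d (\<lambda>_. 0)"
    using period[of "\<lambda>_. 0"] by simp
  moreover have "(\<lambda>i. ?z i + u i) = u(d := u d + 1)"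
    by (auto simp: fun_eq_iff)
  then have "log_form n d u + of_nat d * u 0 ^ (d - 1) = log_form n d ?z"
    using period[of ?z] log_form_upd[OF assms(1), of n u 1] by simp
  moreover have "(0 :: 'a) ^ (d - 1) = 0"
    using assms(1) by (intro zero_power) simp
  then have "log_form n d ?z = log_form n d (\<lambda>_. 0)"
    using log_form_upd[OF assms(1), of n "\<lambda>_. 0 :: 'a" 1] by simp
  ultimately show ?thesis
    using assms(1) by simp
qed

text \<open>Coordinates are eliminated in turn, that of index $0$ by \<open>periods_0_coord\<close>. For $j > d$
  the product $y_j u$ then lies in the socle, with coefficient proportional to $u_j$. If $i < d$ is the smallest index with
  $u_i \<noteq> 0$, then $x^{d-i} u = u_i x^d$. Finally a multiple of $x^d$ itself is excluded by
  \<open>periods_socle\<close>.\<close>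

lemma periods_trivial:
  fixes u :: "nat \<Rightarrow> 'a::field_char_0"
  assumes "2 \<le> d" "d \<le> n" "u \<in> periods n d" "k \<le> n"
  shows "u k = 0"
proof -
  have u0: "u 0 = 0"
    using assms(1,3) by (rule periods_0_coord)
  have high: "u j = 0" if "d < j" "j \<le> n" for j
  proof -
    \<comment> \<open>The group element $\exp(y_j)$.\<close>
    define t where "t = (\<lambda>i. if i = j - 2 then 1 else 0 :: 'a)"
    have exp_series: "exp_series d t = 1"
    proof -
      have "(\<lambda>i. if i < d - 1 then t i else 0) = (\<lambda>_. 0)"
        using that assms(1) by (auto simp: t_def fun_eq_iff)
      then have "exp_series d t = exp_series d (\<lambda>_. 0)"
        by (simp add: exp_series_def)
      then show ?thesis by (simp add: exp_series_zero)
    qed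
    have "act n d t u d = u d"
      by (rule periods_move_to_socle) (use assms in \<open>auto simp: act_def exp_series u0\<close>)
    moreover have "(\<Sum>i\<in>{d<..n}. u 0 * t (i - 2) ^ 2 + 2 * t (i - 2) * u i) =
        (\<Sum>i\<in>{d<..n}. if i = j then 2 * u j else 0)"
      by (intro sum.cong) (use that assms(1) in \<open>auto simp: t_def u0\<close>)
    ultimately show "u j = 0"
      using that assms(1) by (simp add: act_def exp_series)
  qed
  have low: "u i = 0" if "i < d" for i
    using that
  proof (induction i rule: less_induct)
    case (less i)
    show ?case
    proof (cases "i = 0")
      case False
      let ?e = "expo (\<lambda>l. if Suc l = d - i then 1 else 0 :: 'a)"
      \<comment> \<open>The group element $\exp(x^{d-i} / (d-i))$.\<close>
      define t where "t = (\<lambda>l. if Suc l = d - i then 1 else 0 :: 'a)"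
      have exp_series: "exp_series d t = Abs_fps ?e"
      proof -
        have "(\<lambda>l. if l < d - 1 then t l else 0) = t"
          using False by (auto simp: t_def fun_eq_iff)
        then have "exp_series d t = Abs_fps (expo t)"
          by (simp add: exp_series_def)
        then show ?thesis by (simp add: t_def)
      qed
      have tj: "t (j - 2) = 0" if "d < j" for j
        using that False by (auto simp: t_def)
      have e: "?e l = 0" if "0 < l" "l < d - i" for l
        using that by (rule expo_single(2)[rotated]) (use less.prems in simp)
      have "act n d t u d = u d"
      proof (rule periods_move_to_socle)
        fix k assume k: "k \<le> n" "k \<noteq> d"
        have "(Abs_fps u * Abs_fps ?e) $. k = u k" if "k < d"
        proof -
          have "u l * ?e (k - l) = (if l = k then u k else 0)" if "l \<le> k" for l
          proof (cases "l < i")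
            case True
            then show ?thesis
              using less.IH[of l] less.prems by auto
          next
            case False
            then show ?thesis
              using that e[of "k - l"] \<open>k < d\<close> by auto
          qed
          then have "(\<Sum>l=0..k. u l * ?e (k - l)) = (\<Sum>l=0..k. if l = k then u k else 0)"
            by (intro sum.cong) auto
          then show ?thesis
            by (simp add: fps_mult_nth)
        qed
        then show "act n d t u k = u k"
          using k by (auto simp: act_def exp_series u0)
      qed (use assms in auto)
      moreover have "act n d t u d = u d + u i / of_nat (d - i)"
      proof -
        have "u l * ?e (d - l) = (if l = d then u d else 0) + (if l = i then u i / of_nat (d - i) else 0)"
          if le: "l \<le> d" for l
        proof (cases "l < i")
          case True
          then show ?thesis
            using less.IH[of l] less.prems by auto
        next
          case False
          consider "l = i" | "l = d" | "i < l" "l < d"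
            using le \<open>\<not> l < i\<close> by linarith
          then show ?thesis
          proof cases
            case 1
            have "?e (d - i) = 1 / of_nat (d - i)"
              by (rule expo_single(1)) (use less.prems in simp)
            then show ?thesis
              using 1 less.prems by (simp del: of_nat_diff)
          next
            case 2
            then show ?thesis
              using less.prems by simp
          next
            case 3
            then show ?thesis
              using e[of "d - l"] by simp
          qed
        qed
        then have "(\<Sum>l=0..d. u l * ?e (d - l)) =
            (\<Sum>l=0..d. (if l = d then u d else 0) + (if l = i then u i / of_nat (d - i) else 0))"
          by (intro sum.cong) auto
        also have "\<dots> = u d + u i / of_nat (d - i)"
          using less.prems by (simp add: sum.distrib del: of_nat_diff)
        finally show ?thesis
          by (simp add: act_def exp_series fps_mult_nth tj u0 del: of_nat_diff)
      qed
      ultimately show ?thesis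
        using less.prems by (simp del: of_nat_diff)
    qed (use u0 in simp)
  qed
  have "u d = 0"
  proof (rule periods_socle)
    show "u l = 0" if "l \<le> n" "l \<noteq> d" for l
      using low[of l] high[of l] that by linarith
  qed (fact assms)+
  then show ?thesis
    using low[of k] high[of k] assms(4) by (cases k d rule: linorder_cases) simp_all
qed

lemma log_deriv_one_plus_X: "log_deriv (\<lambda>i. if i = Suc 0 then 1 else 0) k = (- 1) ^ k"
proof (induction k)
  case (Suc k)
  have "(\<Sum>i<Suc k. (if Suc k - i = Suc 0 then 1 else 0) * log_deriv (\<lambda>i. if i = Suc 0 then 1 else 0) i) =
      (\<Sum>i<Suc k. if i = k then (- 1) ^ k else 0 :: 'a)"
    by (intro sum.cong) (auto simp: Suc)
  also have "\<dots> = (- 1) ^ k" by simp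
  finally show ?case
    by (simp add: log_deriv.simps[of _ "Suc k"] del: sum.lessThan_Suc)
qed (simp add: log_deriv.simps[of _ 0])

text \<open>Isolates the term $\pm z_1^d$, which survives at $z_0 = 0$.\<close>

lemma log_form_tangent:
  assumes "2 \<le> d"
  shows "log_form n d (\<lambda>i. if i = Suc 0 then 1 else 0) = (- 1 :: 'a::comm_ring_1) ^ (d - 1)"
proof -
  have "log_deriv (\<lambda>i. (if 0 = Suc 0 then 1 else 0) ^ (i - 1) * (if i = Suc 0 then 1 else 0)) (d - 1) =
      log_deriv (\<lambda>i. if i = Suc 0 then 1 else 0 :: 'a) (d - 1)"
    by (rule log_deriv_cong) auto
  then have "log_deriv (\<lambda>i. (if 0 = Suc 0 then 1 else 0) ^ (i - 1) * (if i = Suc 0 then 1 else 0)) (d - 1) =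
      (- 1 :: 'a) ^ (d - 1)"
    by (simp only: log_deriv_one_plus_X)
  moreover have "(\<Sum>j\<in>{d<..n}. (if j = Suc 0 then 1 else 0 :: 'a) ^ 2) = 0"
    using assms by (intro sum.neutral) auto
  ultimately show ?thesis
    by (simp only: log_form_def mult_zero_right add_0_right)
qed

section \<open>Homogeneous polynomials\<close>

text \<open>Both notions of forms in the problem are instances: $V$ contains the admissible variables, and
  the degree is counted in the variables of $W$.\<close>

definition homogeneous_on :: "'v set \<Rightarrow> 'v set \<Rightarrow> nat \<Rightarrow> ('v, 'a::zero) mpoly \<Rightarrow> bool" where
  "homogeneous_on V W e f \<longleftrightarrow> (\<forall>\<mu>\<in>Poly_Mapping.keys f. Poly_Mapping.keys \<mu> \<subseteq> V \<and>
     (\<Sum>j\<in>W. Poly_Mapping.lookup \<mu> j) = e)"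

lemma is_form_homogeneous: "is_form n e f \<longleftrightarrow> homogeneous_on {..n} {..n} e f"
  unfolding is_form_def homogeneous_on_def vars_def by blast

lemma is_relative_form_homogeneous:
  "is_relative_form m n e g \<longleftrightarrow> homogeneous_on (Inl ` {..<m} \<union> Inr ` {..n}) (Inr ` {..n}) e g"
proof -
  have "(\<Sum>j\<in>Inr ` {..n}. Poly_Mapping.lookup \<mu> j) = (\<Sum>j\<le>n. Poly_Mapping.lookup \<mu> (Inr j))"
    for \<mu> :: "nat + nat \<Rightarrow>\<^sub>0 nat"
    by (simp add: sum.reindex inj_on_def)
  then show ?thesis
    unfolding is_relative_form_def homogeneous_on_def vars_def by (simp add: UN_subset_iff) blast
qed

lemma homogeneous_on_0: "homogeneous_on V W e 0"
  by (simp add: homogeneous_on_def)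

lemma homogeneous_on_const: "homogeneous_on V W 0 (Poly_Mapping.single 0 c)"
  by (simp add: homogeneous_on_def)

lemma homogeneous_on_var:
  assumes "finite W" "i \<in> V"
  shows "homogeneous_on V W (if i \<in> W then 1 else 0) (var i)"
proof -
  have "(\<Sum>j\<in>W. Poly_Mapping.lookup (Poly_Mapping.single i (Suc 0)) j) =
      (\<Sum>j\<in>W. if j = i then Suc 0 else 0)"
    by (intro sum.cong) (auto simp: lookup_single when_def)
  also have "\<dots> = (if i \<in> W then Suc 0 else 0)"
    using assms(1) by simp
  finally show ?thesis
    using assms(2) by (simp add: homogeneous_on_def var_def del: sum_eq_0_iff)
qed

lemma homogeneous_on_add:
  assumes "homogeneous_on V W e f" "homogeneous_on V W e g"
  shows "homogeneous_on V W e (f + g)"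
  using assms keys_add[of f g] unfolding homogeneous_on_def by blast

lemma homogeneous_on_mult:
  assumes "homogeneous_on V W e f" "homogeneous_on V W e' g"
  shows "homogeneous_on V W (e + e') (f * g)"
  unfolding homogeneous_on_def
proof
  fix \<mu> assume "\<mu> \<in> Poly_Mapping.keys (f * g)"
  then obtain \<alpha> \<beta> where \<alpha>\<beta>: "\<mu> = \<alpha> + \<beta>" "\<alpha> \<in> Poly_Mapping.keys f" "\<beta> \<in> Poly_Mapping.keys g"
    using keys_mult[of f g] by blast
  have "Poly_Mapping.keys \<mu> \<subseteq> V"
    using assms keys_add[of \<alpha> \<beta>] \<alpha>\<beta> unfolding homogeneous_on_def by blast
  moreover have "(\<Sum>j\<in>W. Poly_Mapping.lookup \<mu> j) = e + e'"
    using assms \<alpha>\<beta> unfolding homogeneous_on_def by (simp add: lookup_add sum.distrib)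
  ultimately show "Poly_Mapping.keys \<mu> \<subseteq> V \<and> (\<Sum>j\<in>W. Poly_Mapping.lookup \<mu> j) = e + e'" ..
qed

lemma homogeneous_on_of_nat_mult:
  assumes "homogeneous_on V W e f"
  shows "homogeneous_on V W e (of_nat k * f)"
  using homogeneous_on_mult[OF homogeneous_on_const assms, of "of_nat k"] by simp

lemma homogeneous_on_diff:
  fixes f g :: "('v, 'a::comm_ring_1) mpoly"
  assumes "homogeneous_on V W e f" "homogeneous_on V W e g"
  shows "homogeneous_on V W e (f - g)"
proof -
  have "homogeneous_on V W (0 + e) (Poly_Mapping.single 0 (- 1) * g)"
    by (intro homogeneous_on_mult homogeneous_on_const assms)
  then have "homogeneous_on V W e (- g)"
    by (simp add: single_uminus)
  from homogeneous_on_add[OF assms(1) this] show ?thesis by simp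
qed

lemma homogeneous_on_power:
  fixes f :: "('v, 'a::comm_semiring_1) mpoly"
  assumes "homogeneous_on V W 1 f"
  shows "homogeneous_on V W k (f ^ k)"
proof (induction k)
  case 0
  then show ?case
    using homogeneous_on_const[of V W "1 :: 'a"] by simp
next
  case (Suc k)
  then show ?case
    using homogeneous_on_mult[OF assms Suc] by simp
qed

lemma homogeneous_on_sum:
  assumes "\<And>x. x \<in> A \<Longrightarrow> homogeneous_on V W e (f x)"
  shows "homogeneous_on V W e (sum f A)"
  using assms
  by (induction A rule: infinite_finite_induct) (simp_all add: homogeneous_on_0 homogeneous_on_add)

lemma homogeneous_on_log_deriv:
  fixes z :: "nat \<Rightarrow> ('v, 'a::comm_ring_1) mpoly"
  assumes "\<And>i. i \<le> Suc k \<Longrightarrow> homogeneous_on V W 1 (z i)"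
  shows "homogeneous_on V W (Suc k) (log_deriv (\<lambda>i. z 0 ^ (i - 1) * z i) k)"
  using assms
proof (induction k rule: less_induct)
  case (less k)
  have coord: "homogeneous_on V W i (z 0 ^ (i - 1) * z i)" if "1 \<le> i" "i \<le> Suc k" for i
    using homogeneous_on_mult[OF homogeneous_on_power[of V W "z 0" "i - 1"], of 1 "z i"] less.prems that by simp
  have "homogeneous_on V W (Suc k) (z 0 ^ (k - i - 1) * z (k - i) * log_deriv (\<lambda>i. z 0 ^ (i - 1) * z i) i)"
    if "i < k" for i
    using homogeneous_on_mult[OF coord[of "k - i"] less.IH[of i]] that less.prems by simp
  then show ?case
    unfolding log_deriv.simps[of _ k]
    by (intro homogeneous_on_diff homogeneous_on_of_nat_mult homogeneous_on_sum coord) auto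
qed

lemma homogeneous_on_log_form:
  fixes z :: "nat \<Rightarrow> ('v, 'a::comm_ring_1) mpoly"
  assumes "2 \<le> d" "d \<le> n" "\<And>i. i \<le> n \<Longrightarrow> homogeneous_on V W 1 (z i)"
  shows "homogeneous_on V W d (log_form n d z)"
proof -
  have "homogeneous_on V W (Suc (d - 1)) (log_deriv (\<lambda>i. z 0 ^ (i - 1) * z i) (d - 1))"
    by (rule homogeneous_on_log_deriv) (use assms in auto)
  moreover have "homogeneous_on V W ((d - 2) + 2) (z 0 ^ (d - 2) * (\<Sum>j\<in>{d<..n}. z j ^ 2))"
    by (intro homogeneous_on_mult homogeneous_on_sum homogeneous_on_power assms) auto
  moreover have "Suc (d - 1) = d" "d - 2 + 2 = d"
    using assms(1) by simp_all
  ultimately show ?thesis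
    unfolding log_form_def by (simp only: homogeneous_on_add)
qed

section \<open>Irreducibility and non-degeneracy\<close>

definition log_poly :: "nat \<Rightarrow> nat \<Rightarrow> (nat, 'a::comm_ring_1) mpoly" where
  "log_poly n d = log_form n d var"

lemma eval_log_form: "eval_mpoly \<rho> (log_form n d z) = log_form n d (\<lambda>i. eval_mpoly \<rho> (z i))"
  by (rule log_form_hom) (simp_all add: eval_mpoly_hom)

lemma eval_log_poly: "eval_mpoly \<rho> (log_poly n d) = log_form n d \<rho>"
  by (simp add: log_poly_def eval_log_form eval_mpoly_var)

lemma is_form_log_poly:
  assumes "2 \<le> d" "d \<le> n"
  shows "is_form n d (log_poly n d)"
  unfolding is_form_homogeneous log_poly_def
proof (rule homogeneous_on_log_form[OF assms])
  show "homogeneous_on {..n} {..n} 1 (var i)" if "i \<le> n" for i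
    using homogeneous_on_var[of "{..n}" i "{..n}"] that by simp
qed

lemma var_power: "var i ^ k = Poly_Mapping.single (Poly_Mapping.single i k) 1"
  by (induction k) (simp_all add: var_def mult_single single_add[symmetric])

lemma vars_single: "c \<noteq> 0 \<Longrightarrow> vars (Poly_Mapping.single \<mu> c) = Poly_Mapping.keys \<mu>"
  by (simp add: vars_def)

lemma poly_in_single:
  "poly_in i (Poly_Mapping.single \<mu> c) = monom (Poly_Mapping.single \<mu> c) (Poly_Mapping.lookup \<mu> i)"
  by (simp add: poly_in_def)

lemma eval_eq_0_of_constant_coeff:
  assumes "coeff (poly_in i f) 0 = 0" "\<rho> i = 0"
  shows "eval_mpoly \<rho> f = 0"
  unfolding eval_mpoly_def
proof (rule sum.neutral, rule ballI)
  fix \<mu> assume \<mu>: "\<mu> \<in> Poly_Mapping.keys f"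
  have "Poly_Mapping.lookup \<mu> i \<noteq> 0"
    using lookup_coeff_poly_in[of i f 0 \<mu>] assms(1) \<mu> by (auto simp: in_keys_iff when_def split: if_splits)
  then have "(\<Prod>j\<in>Poly_Mapping.keys \<mu>. \<rho> j ^ Poly_Mapping.lookup \<mu> j) = 0"
    using assms(2) by (intro prod_zero) (auto simp: in_keys_iff zero_power intro!: bexI[of _ i])
  then show "Poly_Mapping.lookup f \<mu> * (\<Prod>j\<in>Poly_Mapping.keys \<mu>. \<rho> j ^ Poly_Mapping.lookup \<mu> j) = 0"
    by simp
qed

text \<open>The exponent of $z_0^{d-1} z_d$.\<close>

definition top_monomial :: "nat \<Rightarrow> nat \<Rightarrow>\<^sub>0 nat" where
  "top_monomial d = Poly_Mapping.single 0 (d - 1) + Poly_Mapping.single d 1"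

lemma top_term_nonzero:
  assumes "2 \<le> d"
  shows "Poly_Mapping.single (top_monomial d) (of_nat d) \<noteq> (0 :: (nat, 'a::field_char_0) mpoly)"
proof
  assume "Poly_Mapping.single (top_monomial d) (of_nat d) = (0 :: (nat, 'a) mpoly)"
  then have "Poly_Mapping.lookup (Poly_Mapping.single (top_monomial d) (of_nat d :: 'a)) (top_monomial d) = 0"
    by (simp only: lookup_zero)
  then show False
    using assms by simp
qed

text \<open>The last part is the statement that $z_0$ does not divide $g$: otherwise $g$ would vanish at the
  point with $z_1 = 1$ as the only nonzero coordinate.\<close>

lemma log_poly_linear:
  fixes d n :: nat
  assumes "2 \<le> d" "d \<le> n"
  defines "g \<equiv> log_form n d (var(d := 0)) :: (nat, 'a::comm_ring_1) mpoly"
  shows "log_poly n d = g + Poly_Mapping.single (top_monomial d) (of_nat d)"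
    and "d \<notin> vars g"
    and "coeff (poly_in 0 g) 0 \<noteq> 0"
proof -
  have "var = (var(d := 0))(d := (var(d := 0)) d + var d :: (nat, 'a) mpoly)"
    by simp
  then have "log_poly n d = g + of_nat d * (var(d := 0)) 0 ^ (d - 1) * var d"
    unfolding log_poly_def g_def using log_form_upd[OF assms(1)] by metis
  also have "of_nat d * (var(d := 0)) 0 ^ (d - 1) * var d =
      (Poly_Mapping.single (top_monomial d) (of_nat d) :: (nat, 'a) mpoly)"
  proof -
    have "(of_nat d :: (nat, 'a) mpoly) = Poly_Mapping.single 0 (of_nat d)"
      by simp
    then show ?thesis
      using assms(1) by (simp add: var_power del: single_of_nat)
        (simp add: var_def mult_single top_monomial_def del: single_of_nat)
  qed
  finally show "log_poly n d = g + Poly_Mapping.single (top_monomial d) (of_nat d)" .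
  have "homogeneous_on ({..n} - {d}) {..n} d g"
    unfolding g_def
  proof (rule homogeneous_on_log_form[OF assms(1,2)])
    show "homogeneous_on ({..n} - {d}) {..n} 1 ((var(d := 0)) i)" if "i \<le> n" for i
      using homogeneous_on_var[of "{..n}" i "{..n} - {d}"] that by (auto simp: homogeneous_on_0)
  qed
  then show "d \<notin> vars g"
    by (auto simp: homogeneous_on_def vars_def)
  show "coeff (poly_in 0 g) 0 \<noteq> 0"
  proof
    \<comment> \<open>The point whose only nonzero coordinate is $z_1$; it lies on $z_0 = 0$.\<close>
    let ?\<rho> = "\<lambda>i. if i = Suc 0 then 1 else 0 :: 'a"
    assume "coeff (poly_in 0 g) 0 = 0"
    then have "eval_mpoly ?\<rho> g = 0"
      by (rule eval_eq_0_of_constant_coeff) simp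
    moreover have "(\<lambda>i. eval_mpoly ?\<rho> ((var(d := 0)) i)) = ?\<rho>"
      using assms(1) by (auto simp: fun_eq_iff eval_mpoly_var eval_mpoly_0)
    ultimately have "(- 1 :: 'a) ^ (d - 1) = 0"
      using log_form_tangent[OF assms(1), of n, where 'a='a] by (simp add: g_def eval_log_form)
    moreover have "(- 1 :: 'a) ^ (d - 1) * (- 1) ^ (d - 1) = 1"
      by (simp add: power_mult_distrib[symmetric])
    ultimately show False by simp
  qed
qed

lemma poly_in_log_poly:
  assumes "2 \<le> d" "d \<le> n"
  shows "poly_in d (log_poly n d) =
    [:log_form n d (var(d := 0)), Poly_Mapping.single (top_monomial d) (of_nat d):]"
proof -
  have "Poly_Mapping.lookup (top_monomial d) d = 1"
    using assms(1) by (simp add: top_monomial_def lookup_add lookup_single)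
  then show ?thesis
    by (simp add: log_poly_linear(1)[OF assms] poly_in_add poly_in_single
        poly_in_const log_poly_linear(2)[OF assms] monom_altdef)
qed

text \<open>Comparing coefficients of powers of $z_d$ shows that $b$ divides both $z_0^{d-1} z_d$ and $g$.
  The first leaves $z_0$ as the only possible variable of $b$, and makes $b$ a monomial; the second
  excludes positive powers of $z_0$.\<close>

lemma log_poly_factor_unit:
  fixes a b :: "(nat, 'a::field_char_0) mpoly"
  assumes "2 \<le> d" "d \<le> n" "log_poly n d = a * b" "d \<notin> vars b"
  shows "b dvd 1"
proof -
  let ?g = "log_form n d (var(d := 0)) :: (nat, 'a) mpoly"
  let ?h = "Poly_Mapping.single (top_monomial d) (of_nat d) :: (nat, 'a) mpoly"
  have "poly_in d a * [:b:] = [:?g, ?h:]"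
    using poly_in_log_poly[OF assms(1,2), where 'a='a] assms(3) poly_in_const[OF assms(4)]
    by (simp add: poly_in_mult)
  then have factors: "coeff [:?g, ?h:] k = coeff (poly_in d a) k * b" for k
    by (simp add: mult.commute[of _ b] flip: coeff_smult)
  define a0 a1 where "a0 = coeff (poly_in d a) 0" and "a1 = coeff (poly_in d a) 1"
  have g: "?g = a0 * b" and h: "?h = a1 * b"
    using factors[of 0] factors[of 1] by (simp_all add: a0_def a1_def)
  have h0: "?h \<noteq> 0"
    using assms(1) by (rule top_term_nonzero)
  then have nz: "a1 \<noteq> 0" "b \<noteq> 0"
    using h by auto
  have keys: "Poly_Mapping.keys (top_monomial d) \<subseteq> {0, d}"
    using keys_add[of "Poly_Mapping.single 0 (d - 1)" "Poly_Mapping.single d (1::nat)"]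
    by (auto simp: top_monomial_def split: if_splits)
  have "vars b \<subseteq> vars ?h"
    using vars_mult[OF nz] h by simp
  also have "\<dots> = Poly_Mapping.keys (top_monomial d)"
    using assms(1) by (intro vars_single) simp
  finally have vars_b: "vars b \<subseteq> {0}"
    using keys assms(4) by blast
  have "Polynomial.degree (poly_in 0 b) = 0"
  proof (rule degree_0_of_mult_eq_monom)
    show "poly_in 0 a1 * poly_in 0 b = monom ?h (Poly_Mapping.lookup (top_monomial d) 0)"
      by (simp only: poly_in_mult[symmetric] h[symmetric] poly_in_single)
    show "coeff (poly_in 0 b) 0 \<noteq> 0"
      using log_poly_linear(3)[OF assms(1,2), where 'a='a] by (auto simp: g poly_in_mult coeff_mult_0)
  qed (rule h0)
  then have "vars b = {}"
    using vars_b by (auto simp: degree_poly_in_eq_0_iff)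
  then show ?thesis
    using nz(2) by (rule vars_empty_unit)
qed

lemma irreducible_log_poly:
  assumes "2 \<le> d" "d \<le> n"
  shows "irreducible (log_poly n d :: (nat, 'a::field_char_0) mpoly)"
proof (rule irreducibleI)
  let ?f = "log_poly n d :: (nat, 'a) mpoly"
  have "Poly_Mapping.single (top_monomial d) (of_nat d) \<noteq> (0 :: (nat, 'a) mpoly)"
    using assms(1) by (rule top_term_nonzero)
  then have deg: "Polynomial.degree (poly_in d ?f) = 1"
    by (simp add: poly_in_log_poly[OF assms])
  then show nz: "?f \<noteq> 0"
    by (auto simp: poly_in_eq_0_iff[symmetric, of _ d])
  have "d \<in> vars ?f"
    using deg degree_poly_in_eq_0_iff[of d ?f] by auto
  moreover have "vars (1 :: (nat, 'a) mpoly) = {}"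
    by (simp add: vars_def)
  ultimately show "\<not> ?f dvd 1"
    using nz vars_mult[of ?f] by (metis UnI1 dvdE empty_iff mult_zero_right zero_neq_one)
  fix a b assume f: "?f = a * b"
  then have "Polynomial.degree (poly_in d a) + Polynomial.degree (poly_in d b) = 1"
    using deg nz by (simp add: poly_in_mult degree_mult_eq poly_in_eq_0_iff)
  then consider "d \<notin> vars b" | "d \<notin> vars a"
    unfolding degree_poly_in_eq_0_iff[symmetric] by linarith
  then show "a dvd 1 \<or> b dvd 1"
  proof cases
    case 1
    then show ?thesis using log_poly_factor_unit[OF assms f] by blast
  next
    case 2
    have "?f = b * a" using f by (simp add: mult.commute)
    then show ?thesis using log_poly_factor_unit[OF assms] 2 by blast
  qed
qed

lemma eval_linear_change:
  "eval_mpoly \<rho> (linear_change n A f) = eval_mpoly (\<lambda>i. \<Sum>j\<le>n. A $$ (i, j) * \<rho> j) f"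
  by (simp add: linear_change_def eval_subst_mpoly eval_mpoly_hom)

text \<open>If the form $f \circ A$ does not involve $z_j$, then $f$ is invariant under the translation by
  column $j$ of $A$.\<close>

lemma non_degenerate_log_poly:
  assumes "2 \<le> d" "d \<le> n"
  shows "non_degenerate n (log_poly n d :: (nat, 'a::field_char_0) mpoly)"
  unfolding non_degenerate_def
proof (intro notI, elim bexE conjE)
  fix A :: "'a mat"
  let ?h = "linear_change n A (log_poly n d)"
  assume A: "A \<in> carrier_mat (Suc n) (Suc n)" and inv: "invertible_mat A" and card: "card (vars ?h) < Suc n"
  obtain B where AB: "A * B = 1\<^sub>m (Suc n)" and BA: "B * A = 1\<^sub>m (Suc n)" and B: "B \<in> carrier_mat (Suc n) (Suc n)"
  proof -
    obtain B where B: "inverts_mat A B" "inverts_mat B A"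
      using inv by (auto simp: invertible_mat_def)
    have AB: "A * B = 1\<^sub>m (Suc n)" and BA: "B * A = 1\<^sub>m (dim_row B)"
      using B A by (auto simp: inverts_mat_def)
    have "dim_col B = Suc n" "dim_row B = Suc n"
      using arg_cong[OF AB, of dim_col] arg_cong[OF BA, of dim_col] A by auto
    then show ?thesis
      using that[of B] AB BA by auto
  qed
  have "\<not> {..n} \<subseteq> vars ?h"
    using card card_mono[OF finite_vars, of "{..n}" ?h] by auto
  then obtain j where j: "j \<le> n" "j \<notin> vars ?h"
    by auto
  define u where "u = (\<lambda>i. A $$ (i, j))"
  have "u \<in> periods n d"
    unfolding periods_def
  proof (intro CollectI allI)
    fix w :: "nat \<Rightarrow> 'a"
    define v where "v = (\<lambda>l. \<Sum>k\<le>n. B $$ (l, k) * w k)"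
    have Av: "(\<Sum>l\<le>n. A $$ (i, l) * v l) = w i" if "i \<le> n" for i
    proof -
      have "(\<Sum>l\<le>n. A $$ (i, l) * v l) = (\<Sum>k\<le>n. (\<Sum>l\<le>n. A $$ (i, l) * B $$ (l, k)) * w k)"
        unfolding v_def sum_distrib_left sum_distrib_right by (subst sum.swap) (simp add: mult.assoc)
      also have "\<dots> = (\<Sum>k\<le>n. if k = i then w k else 0)"
      proof (intro sum.cong refl)
        fix k assume "k \<in> {..n}"
        then have "(\<Sum>l\<le>n. A $$ (i, l) * B $$ (l, k)) = (A * B) $$ (i, k)"
          using A B that by (simp add: scalar_prod_def atLeast0LessThan lessThan_Suc_atMost)
        then show "(\<Sum>l\<le>n. A $$ (i, l) * B $$ (l, k)) * w k = (if k = i then w k else 0)"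
          using \<open>k \<in> {..n}\<close> that by (simp add: AB)
      qed
      finally show ?thesis
        using that by simp
    qed
    have "log_form n d w = eval_mpoly v ?h"
      unfolding eval_linear_change eval_log_poly by (rule log_form_cong) (use Av assms in auto)
    also have "\<dots> = eval_mpoly (v(j := v j + 1)) ?h"
      by (rule eval_mpoly_cong) (use j in auto)
    also have "\<dots> = log_form n d (\<lambda>i. w i + u i)"
      unfolding eval_linear_change eval_log_poly
    proof (rule log_form_cong)
      fix i assume "i \<le> n"
      have "(\<Sum>l\<le>n. A $$ (i, l) * (v(j := v j + 1)) l) =
          (\<Sum>l\<le>n. A $$ (i, l) * v l + (if l = j then A $$ (i, j) else 0))"
        by (intro sum.cong) (auto simp: algebra_simps)
      then show "(\<Sum>l\<le>n. A $$ (i, l) * (v(j := v j + 1)) l) = w i + u i"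
        using j(1) Av[OF \<open>i \<le> n\<close>] by (simp add: sum.distrib u_def)
    qed (use assms in auto)
    finally show "log_form n d (\<lambda>i. w i + u i) = log_form n d w" ..
  qed
  then have "A $$ (i, j) = 0" if "i \<le> n" for i
    using periods_trivial[OF assms _ that, of u] by (simp add: u_def)
  then have "(B * A) $$ (j, j) = 0"
    using A B j(1) by (simp add: scalar_prod_def)
  then show False
    using j(1) by (simp add: BA)
qed

section \<open>Regularity of the action\<close>

text \<open>Functions given by elements of $K[t][z]$ homogeneous of degree $e$ in $z$. Closure properties
  of this class show that the coordinates of the action are of this kind, without
  exhibiting the polynomials.\<close>

definition relative_function ::
    "nat \<Rightarrow> nat \<Rightarrow> nat \<Rightarrow> ('a::field vec \<Rightarrow> 'a vec \<Rightarrow> 'a) \<Rightarrow> bool" where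
  "relative_function m n e h \<longleftrightarrow>
     (\<exists>g. is_relative_form m n e g \<and> (\<forall>t v. eval_relative g t v = h t v))"

lemma relative_function_const: "relative_function m n 0 (\<lambda>t v. c)"
  unfolding relative_function_def is_relative_form_homogeneous
  by (rule exI[of _ "Poly_Mapping.single 0 c"])
     (simp add: homogeneous_on_const eval_relative_def eval_mpoly_const)

lemma relative_function_time:
  assumes "i < m"
  shows "relative_function m n 0 (\<lambda>t v. t $ i)"
  unfolding relative_function_def is_relative_form_homogeneous
proof (intro exI conjI allI)
  show "homogeneous_on (Inl ` {..<m} \<union> Inr ` {..n}) (Inr ` {..n}) 0 (var (Inl i))"
    using homogeneous_on_var[of "Inr ` {..n} :: (nat + nat) set" "Inl i" "Inl ` {..<m} \<union> Inr ` {..n}"]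
      assms by (auto split: if_splits)
qed (simp add: eval_relative_def eval_mpoly_var)

lemma relative_function_coord:
  assumes "j \<le> n"
  shows "relative_function m n 1 (\<lambda>t v. v $ j)"
  unfolding relative_function_def is_relative_form_homogeneous
proof (intro exI conjI allI)
  show "homogeneous_on (Inl ` {..<m} \<union> Inr ` {..n}) (Inr ` {..n}) 1 (var (Inr j))"
    using homogeneous_on_var[of "Inr ` {..n} :: (nat + nat) set" "Inr j" "Inl ` {..<m} \<union> Inr ` {..n}"]
      assms by (auto split: if_splits)
qed (simp add: eval_relative_def eval_mpoly_var)

lemma relative_function_add:
  assumes "relative_function m n e g" "relative_function m n e h"
  shows "relative_function m n e (\<lambda>t v. g t v + h t v)"
proof -
  obtain p q where "is_relative_form m n e p" "\<And>t v. eval_relative p t v = g t v"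
    "is_relative_form m n e q" "\<And>t v. eval_relative q t v = h t v"
    using assms by (auto simp: relative_function_def)
  then show ?thesis
    unfolding relative_function_def is_relative_form_homogeneous
    by (intro exI[of _ "p + q"]) (simp add: homogeneous_on_add eval_relative_def eval_mpoly_add)
qed

lemma relative_function_mult:
  assumes "relative_function m n e g" "relative_function m n e' h"
  shows "relative_function m n (e + e') (\<lambda>t v. g t v * h t v)"
proof -
  obtain p q where "is_relative_form m n e p" "\<And>t v. eval_relative p t v = g t v"
    "is_relative_form m n e' q" "\<And>t v. eval_relative q t v = h t v"
    using assms by (auto simp: relative_function_def)
  then show ?thesis
    unfolding relative_function_def is_relative_form_homogeneous
    by (intro exI[of _ "p * q"]) (simp add: homogeneous_on_mult eval_relative_def eval_mpoly_mult)
qed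

lemma relative_function_zero: "relative_function m n e (\<lambda>t v. 0)"
  unfolding relative_function_def is_relative_form_homogeneous
  by (rule exI[of _ 0]) (simp add: homogeneous_on_0 eval_relative_def eval_mpoly_0)

lemma relative_function_sum:
  assumes "\<And>x. x \<in> A \<Longrightarrow> relative_function m n e (f x)"
  shows "relative_function m n e (\<lambda>t v. \<Sum>x\<in>A. f x t v)"
  using assms
  by (induction A rule: infinite_finite_induct) (simp_all add: relative_function_zero relative_function_add)

lemma relative_function_scale:
  assumes "relative_function m n e h"
  shows "relative_function m n e (\<lambda>t v. c * h t v)"
  using relative_function_mult[OF relative_function_const assms] by simp

lemma relative_function_expo:
  assumes "\<And>i. i < k \<Longrightarrow> relative_function m n 0 (\<lambda>t v. u t i)"
  shows "relative_function m n 0 (\<lambda>t v. expo (u t) k)"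
  using assms
proof (induction k rule: less_induct)
  case (less k)
  show ?case
  proof (cases k)
    case 0
    then show ?thesis by (simp add: relative_function_const)
  next
    case (Suc l)
    have "relative_function m n 0 (\<lambda>t v. u t i * expo (u t) (l - i))" if "i \<le> l" for i
      using relative_function_mult[OF less.prems[of i] less.IH[of "l - i"]] less.prems that Suc by simp
    then have "relative_function m n 0 (\<lambda>t v. 1 / of_nat (Suc l) * (\<Sum>i\<le>l. u t i * expo (u t) (l - i)))"
      by (intro relative_function_scale relative_function_sum) simp
    then show ?thesis
      by (simp add: Suc expo.simps(2) del: of_nat_Suc)
  qed
qed

lemma relative_function_act:
  assumes "2 \<le> d" "d \<le> n" "k \<le> n"
  shows "relative_function (n - 1) n 1 (\<lambda>t v. act n d (($) t) (($) v) k)"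
proof -
  have series: "relative_function (n - 1) n 1 (\<lambda>t v. (Abs_fps (($) v) * exp_series d (($) t)) $. l)" if "l \<le> d" for l
  proof -
    have "relative_function (n - 1) n 1
        (\<lambda>t v. v $ i * expo (\<lambda>i. if i < d - 1 then t $ i else 0) (l - i))" if "i \<le> l" for i
    proof -
      have "relative_function (n - 1) n (1 + 0)
          (\<lambda>t v. v $ i * expo (\<lambda>i. if i < d - 1 then t $ i else 0) (l - i))"
      proof (intro relative_function_mult relative_function_coord relative_function_expo)
        show "i \<le> n" using that \<open>l \<le> d\<close> assms by simp
        show "relative_function (n - 1) n 0 (\<lambda>t v. if j < d - 1 then t $ j else 0)" for j
          using assms by (cases "j < d - 1") (simp_all add: relative_function_zero relative_function_time)
      qed
      then show ?thesis by simp
    qed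
    then have "relative_function (n - 1) n 1
        (\<lambda>t v. \<Sum>i=0..l. v $ i * expo (\<lambda>i. if i < d - 1 then t $ i else 0) (l - i))"
      by (intro relative_function_sum) simp
    then show ?thesis
      by (simp add: fps_mult_nth exp_series_def)
  qed
  have time: "relative_function (n - 1) n 0 (\<lambda>t v. t $ (j - 2))" if "d < j" "j \<le> n" for j
    using that assms(1) by (intro relative_function_time) linarith
  have square: "relative_function (n - 1) n 1
      (\<lambda>t v. v $ 0 * (t $ (j - 2)) ^ 2 + 2 * t $ (j - 2) * v $ j)" if "d < j" "j \<le> n" for j
  proof -
    have "relative_function (n - 1) n (1 + (0 + 0)) (\<lambda>t v. v $ 0 * (t $ (j - 2) * t $ (j - 2)))"
      by (intro relative_function_mult relative_function_coord time that) simp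
    moreover have "relative_function (n - 1) n (0 + 1) (\<lambda>t v. (2 * t $ (j - 2)) * v $ j)"
      by (intro relative_function_mult relative_function_scale relative_function_coord time that)
    ultimately show ?thesis
      using relative_function_add by (fastforce simp: power2_eq_square)
  qed
  consider "k < d" | "k = d" | "k > d" by linarith
  then show ?thesis
  proof cases
    case 1
    then show ?thesis
      using series[of k] by (simp add: act_def)
  next
    case 2
    have "relative_function (n - 1) n 1 (\<lambda>t v. (Abs_fps (($) v) * exp_series d (($) t)) $. d +
        (- 1 / of_nat d) * (\<Sum>j\<in>{d<..n}. v $ 0 * (t $ (j - 2)) ^ 2 + 2 * t $ (j - 2) * v $ j))"
      by (intro relative_function_add relative_function_scale relative_function_sum series square) auto
    then show ?thesis
      by (simp add: act_def 2)
  next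
    case 3
    have "relative_function (n - 1) n (1 + 0) (\<lambda>t v. v $ 0 * t $ (k - 2))"
      by (intro relative_function_mult relative_function_coord time 3 assms) simp
    then have "relative_function (n - 1) n 1 (\<lambda>t v. v $ k + v $ 0 * t $ (k - 2))"
      using assms(3) by (intro relative_function_add relative_function_coord) simp_all
    then show ?thesis
      using 3 by (simp add: act_def)
  qed
qed

section \<open>The induced additive action\<close>

lemma act_cong:
  assumes "2 \<le> d" "d \<le> n" "k \<le> n"
    and "\<And>i. i < n - 1 \<Longrightarrow> s i = t i" "\<And>i. i \<le> n \<Longrightarrow> v i = w i"
  shows "act n d s v k = act n d t w k"
proof -
  have "(\<lambda>i. if i < d - 1 then s i else 0) = (\<lambda>i. if i < d - 1 then t i else 0)"
    using assms by (auto simp: fun_eq_iff)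
  then have exp_series: "exp_series d s = exp_series d t"
    by (simp add: exp_series_def)
  have series: "(Abs_fps v * e) $. l = (Abs_fps w * e) $. l" if "l \<le> d" for l e
    using that assms by (intro fps_mult_nth_cong) auto
  have st: "s (j - 2) = t (j - 2)" if "d < j" "j \<le> n" for j
    using that assms(1) by (intro assms(4)) linarith
  have "(\<Sum>j\<in>{d<..n}. v 0 * s (j - 2) ^ 2 + 2 * s (j - 2) * v j) =
      (\<Sum>j\<in>{d<..n}. w 0 * t (j - 2) ^ 2 + 2 * t (j - 2) * w j)"
    by (intro sum.cong) (simp_all add: st assms(5))
  then show ?thesis
    unfolding act_def exp_series using series st[of k] assms(3,5) by simp
qed

definition act_vec :: "nat \<Rightarrow> nat \<Rightarrow> 'a::field_char_0 vec \<Rightarrow> 'a vec \<Rightarrow> 'a vec" where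
  "act_vec n d t v = vec (Suc n) (act n d (($) t) (($) v))"

lemma act_vec_carrier [simp]: "act_vec n d t v \<in> carrier_vec (Suc n)"
  by (simp add: act_vec_def)

lemma dim_act_vec [simp]: "dim_vec (act_vec n d t v) = Suc n"
  by (simp add: act_vec_def)

lemma act_vec_index [simp]: "i \<le> n \<Longrightarrow> act_vec n d t v $ i = act n d (($) t) (($) v) i"
  by (simp add: act_vec_def)

lemma eval_form_act_vec:
  assumes "2 \<le> d" "d \<le> n"
  shows "eval_form (log_poly n d) (act_vec n d t v) = eval_form (log_poly n d) v"
proof -
  have "log_form n d (($) (act_vec n d t v)) = log_form n d (act n d (($) t) (($) v))"
    by (rule log_form_cong) (use assms in auto)
  then show ?thesis
    by (simp add: eval_form_def eval_log_poly log_form_act assms)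
qed

lemma act_vec_zero:
  assumes "2 \<le> d" "d \<le> n" "v \<in> carrier_vec (Suc n)"
  shows "act_vec n d (0\<^sub>v (n - 1)) v = v"
proof (rule eq_vecI)
  fix i assume "i < dim_vec v"
  then have i: "i \<le> n" using assms(3) by simp
  have "act n d (($) (0\<^sub>v (n - 1))) (($) v) i = act n d (\<lambda>_. 0) (($) v) i"
    by (rule act_cong) (use assms i in auto)
  then show "act_vec n d (0\<^sub>v (n - 1)) v $ i = v $ i"
    using i by (simp add: act_zero)
qed (use assms(3) in \<open>simp add: act_vec_def\<close>)

lemma act_vec_add:
  assumes "2 \<le> d" "d \<le> n" "s \<in> carrier_vec (n - 1)" "t \<in> carrier_vec (n - 1)"
  shows "act_vec n d (s + t) v = act_vec n d s (act_vec n d t v)"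
proof (rule eq_vecI)
  fix i assume "i < dim_vec (act_vec n d s (act_vec n d t v))"
  then have i: "i \<le> n" by (simp add: act_vec_def)
  have "act n d (($) (s + t)) (($) v) i = act n d (\<lambda>i. s $ i + t $ i) (($) v) i"
    by (rule act_cong) (use assms i in auto)
  also have "\<dots> = act n d (($) s) (act n d (($) t) (($) v)) i"
    by (rule act_add[OF assms(1)])
  also have "\<dots> = act n d (($) s) (($) (act_vec n d t v)) i"
    by (rule act_cong) (use assms i in auto)
  finally show "act_vec n d (s + t) v $ i = act_vec n d s (act_vec n d t v) $ i"
    using i by simp
qed (simp add: act_vec_def)

lemma act_vec_smult:
  assumes "2 \<le> d" "d \<le> n" "v \<in> carrier_vec (Suc n)"
  shows "act_vec n d t (c \<cdot>\<^sub>v v) = c \<cdot>\<^sub>v act_vec n d t v"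
proof (rule eq_vecI)
  fix i assume "i < dim_vec (c \<cdot>\<^sub>v act_vec n d t v)"
  then have i: "i \<le> n" by (simp add: act_vec_def)
  have zero: "act n d (($) t) (\<lambda>_. 0) i = 0"
    using act_linear[of n d "($) t" 0 "\<lambda>_. 0" "\<lambda>_. 0" i] act_linear[of n d "($) t" 1 "\<lambda>_. 0" "\<lambda>_. 0" i] by simp
  have "act n d (($) t) (($) (c \<cdot>\<^sub>v v)) i = act n d (($) t) (\<lambda>i. c * v $ i + 0) i"
    by (rule act_cong) (use assms i in auto)
  also have "\<dots> = c * act n d (($) t) (($) v) i"
    using act_linear[of n d "($) t" c "($) v" "\<lambda>_. 0" i] zero by simp
  finally show "act_vec n d t (c \<cdot>\<^sub>v v) $ i = (c \<cdot>\<^sub>v act_vec n d t v) $ i"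
    using i by (simp add: act_vec_def)
qed (simp add: act_vec_def)

text \<open>The action is invertible and maps the zero vector to itself.\<close>

lemma act_vec_nonzero:
  assumes "2 \<le> d" "d \<le> n" "t \<in> carrier_vec (n - 1)" "v \<in> carrier_vec (Suc n)" "v \<noteq> 0\<^sub>v (Suc n)"
  shows "act_vec n d t v \<noteq> 0\<^sub>v (Suc n)"
proof
  assume 0: "act_vec n d t v = 0\<^sub>v (Suc n)"
  have "v = act_vec n d (- t + t) v"
    using act_vec_zero[OF assms(1,2,4)] by (simp add: uminus_l_inv_vec[OF assms(3)])
  also have "\<dots> = act_vec n d (- t) (act_vec n d t v)"
    by (rule act_vec_add) (use assms in auto)
  \<comment> \<open>Writing zero as a multiple makes homogeneity of the action applicable.\<close>
  also have "act_vec n d t v = 0 \<cdot>\<^sub>v 0\<^sub>v (Suc n)"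
    unfolding 0 by (rule eq_vecI) simp_all
  also have "act_vec n d (- t) (0 \<cdot>\<^sub>v 0\<^sub>v (Suc n)) = 0 \<cdot>\<^sub>v act_vec n d (- t) (0\<^sub>v (Suc n))"
    by (rule act_vec_smult) (use assms in auto)
  also have "\<dots> = 0\<^sub>v (Suc n)"
    by (rule eq_vecI) (simp_all add: act_vec_def)
  finally show False
    using assms(5) by simp
qed

lemma proj_point_self: "v \<in> proj_point v"
  unfolding proj_point_def by (rule CollectI, rule exI[of _ 1]) simp

lemma proj_point_smult: "c \<noteq> 0 \<Longrightarrow> proj_point (c \<cdot>\<^sub>v v) = proj_point v"
proof -
  assume c: "c \<noteq> 0"
  have "x \<in> proj_point (c \<cdot>\<^sub>v v)" if x: "x \<in> proj_point v" for x
  proof -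
    obtain b where "x = b \<cdot>\<^sub>v v" "b \<noteq> 0"
      using x by (auto simp: proj_point_def)
    then have "x = (b / c) \<cdot>\<^sub>v (c \<cdot>\<^sub>v v)" "b / c \<noteq> 0"
      using c by (simp_all add: smult_smult_assoc)
    then show ?thesis by (auto simp: proj_point_def)
  qed
  moreover have "x \<in> proj_point v" if "x \<in> proj_point (c \<cdot>\<^sub>v v)" for x
    using that c by (auto simp: proj_point_def smult_smult_assoc)
  ultimately show ?thesis by blast
qed

lemma proj_spaceD:
  assumes "p \<in> proj_space n" "v \<in> p"
  shows "v \<in> carrier_vec (Suc n)" "v \<noteq> 0\<^sub>v (Suc n)" "p = proj_point v"
proof -
  obtain w c where w: "w \<in> carrier_vec (Suc n)" "w \<noteq> 0\<^sub>v (Suc n)" "p = proj_point w"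
    and v: "v = c \<cdot>\<^sub>v w" "c \<noteq> 0"
    using assms by (auto simp: proj_space_def proj_point_def)
  show "v \<in> carrier_vec (Suc n)" "p = proj_point v"
    using w v by (simp_all add: proj_point_smult)
  have "w = inverse c \<cdot>\<^sub>v v"
    using v by (simp add: smult_smult_assoc)
  then show "v \<noteq> 0\<^sub>v (Suc n)"
    using w(2) by auto
qed

lemma image_act_vec_proj_point:
  assumes "2 \<le> d" "d \<le> n" "v \<in> carrier_vec (Suc n)"
  shows "act_vec n d t ` proj_point v = proj_point (act_vec n d t v)"
proof -
  have "act_vec n d t ` proj_point v = (\<lambda>c. act_vec n d t (c \<cdot>\<^sub>v v)) ` {c. c \<noteq> 0}"
    by (auto simp: proj_point_def)
  also have "\<dots> = (\<lambda>c. c \<cdot>\<^sub>v act_vec n d t v) ` {c. c \<noteq> 0}"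
    by (simp add: act_vec_smult assms)
  finally show ?thesis
    by (auto simp: proj_point_def)
qed

text \<open>A point is the set of its coordinate vectors, so a linear map acts by taking images.\<close>

definition proj_act :: "nat \<Rightarrow> nat \<Rightarrow> 'a::field_char_0 vec \<Rightarrow> 'a vec set \<Rightarrow> 'a vec set" where
  "proj_act n d t p = act_vec n d t ` p"

lemma proj_act_in_proj_space:
  assumes "2 \<le> d" "d \<le> n" "t \<in> carrier_vec (n - 1)" "p \<in> proj_space n"
  shows "proj_act n d t p \<in> proj_space n"
proof -
  obtain v where v: "v \<in> carrier_vec (Suc n)" "v \<noteq> 0\<^sub>v (Suc n)" "p = proj_point v"
    using assms(4) by (auto simp: proj_space_def)
  then show ?thesis
    using assms by (simp add: proj_act_def image_act_vec_proj_point proj_space_def act_vec_nonzero)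
qed

text \<open>A single tuple of polynomials describes the map everywhere, as linear automorphisms have no
  base points.\<close>

lemma regular_map_proj_act:
  assumes "2 \<le> d" "d \<le> n" "X \<subseteq> proj_space n"
  shows "regular_map (n - 1) n X (proj_act n d :: 'a::field_char_0 vec \<Rightarrow> _)"
  unfolding regular_map_def
proof (intro ballI)
  fix t\<^sub>0 :: "'a vec" and p\<^sub>0 assume t0: "t\<^sub>0 \<in> carrier_vec (n - 1)" and p0: "p\<^sub>0 \<in> X"
  let ?S = "subtopology (zariski_affine_proj (n - 1) n) (carrier_vec (n - 1) \<times> X)"
  let ?G = "{{(t, p). t \<in> carrier_vec (n - 1) \<and> p \<in> proj_space n \<and> (\<forall>v\<in>p. eval_relative g t v \<noteq> 0)}
       | g :: (nat + nat, 'a) mpoly. \<exists>e. is_relative_form (n - 1) n e g}"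
  have whole: "openin ?S (carrier_vec (n - 1) \<times> X)"
    unfolding openin_subtopology_refl
  proof -
    have "is_relative_form (n - 1) n 0 (1 :: (nat + nat, 'a) mpoly)"
      using homogeneous_on_const[of _ _ "1 :: 'a"] by (simp add: is_relative_form_homogeneous)
    then have "{(t, p). t \<in> carrier_vec (n - 1) \<and> p \<in> proj_space n \<and>
        (\<forall>v\<in>p. eval_relative (1 :: (nat + nat, 'a) mpoly) t v \<noteq> 0)} \<in> ?G"
      by blast
    then have "{(t, p). t \<in> carrier_vec (n - 1) \<and> p \<in> proj_space n \<and>
        (\<forall>v\<in>p. eval_relative (1 :: (nat + nat, 'a) mpoly) t v \<noteq> 0)}
        \<subseteq> topspace (zariski_affine_proj (n - 1) n)"
      unfolding zariski_affine_proj_def topology_generated_by_topspace by (rule Union_upper)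
    then show "carrier_vec (n - 1) \<times> X \<subseteq> topspace (zariski_affine_proj (n - 1) n)"
      using assms(3) by (auto simp: eval_relative_def eval_mpoly_1)
  qed
  have "\<forall>i. i \<le> n \<longrightarrow> (\<exists>g. is_relative_form (n - 1) n 1 g \<and>
      (\<forall>t v. eval_relative g t v = act n d (($) t) (($) v :: nat \<Rightarrow> 'a) i))"
    using relative_function_act[OF assms(1,2), where 'a='a] unfolding relative_function_def by blast
  then obtain F where F: "\<And>i. i \<le> n \<Longrightarrow> is_relative_form (n - 1) n 1 (F i)"
    "\<And>i t v. i \<le> n \<Longrightarrow> eval_relative (F i) t v = act n d (($) t) (($) v :: nat \<Rightarrow> 'a) i"
    by metis
  have F_act: "vec (Suc n) (\<lambda>i. eval_relative (F i) t v) = act_vec n d t v" for t v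
    by (rule eq_vecI) (simp_all add: F act_vec_def)
  have "\<forall>(t, p)\<in>carrier_vec (n - 1) \<times> X. \<forall>v\<in>p.
      let w = vec (Suc n) (\<lambda>i. eval_relative (F i) t v)
      in w \<noteq> 0\<^sub>v (Suc n) \<and> proj_act n d t p = proj_point w"
  proof (clarify)
    fix t v :: "'a vec" and p assume *: "t \<in> carrier_vec (n - 1)" "p \<in> X" "v \<in> p"
    then have "p \<in> proj_space n" using assms(3) by blast
    note v = proj_spaceD[OF this \<open>v \<in> p\<close>]
    show "let w = vec (Suc n) (\<lambda>i. eval_relative (F i) t v)
      in w \<noteq> 0\<^sub>v (Suc n) \<and> proj_act n d t p = proj_point w"
      unfolding Let_def F_act proj_act_def
      using act_vec_nonzero[OF assms(1,2) *(1) v(1,2)] image_act_vec_proj_point[OF assms(1,2) v(1)] v(3) by simp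
  qed
  then show "\<exists>U e F. openin ?S U \<and> (t\<^sub>0, p\<^sub>0) \<in> U \<and> (\<forall>i\<le>n. is_relative_form (n - 1) n e (F i)) \<and>
      (\<forall>(t, p)\<in>U. \<forall>v\<in>p. let w = vec (Suc n) (\<lambda>i. eval_relative (F i) t v)
        in w \<noteq> 0\<^sub>v (Suc n) \<and> proj_act n d t p = proj_point w)"
    using whole t0 p0 F(1)
    by (intro exI[of _ "carrier_vec (n - 1) \<times> X"] exI[of _ 1] exI[of _ F] conjI) auto
qed

lemma regular_action_proj_act:
  assumes "2 \<le> d" "d \<le> n" "X \<subseteq> proj_space n"
    and "\<And>t p. t \<in> carrier_vec (n - 1) \<Longrightarrow> p \<in> X \<Longrightarrow> proj_act n d t p \<in> X"
  shows "regular_action (n - 1) n X (proj_act n d :: 'a::field_char_0 vec \<Rightarrow> _)"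
  unfolding regular_action_def
proof (intro conjI ballI)
  fix p assume "p \<in> X"
  then have "v \<in> carrier_vec (Suc n)" if "v \<in> p" for v
    using proj_spaceD(1)[OF _ that] assms(3) by blast
  then have "act_vec n d (0\<^sub>v (n - 1)) ` p = (\<lambda>v. v) ` p"
    by (intro image_cong refl act_vec_zero assms)
  then show "proj_act n d (0\<^sub>v (n - 1)) p = p"
    by (simp add: proj_act_def)
next
  fix s t :: "'a vec" and p assume "s \<in> carrier_vec (n - 1)" "t \<in> carrier_vec (n - 1)"
  then show "proj_act n d (s + t) p = proj_act n d s (proj_act n d t p)"
    using assms by (simp add: proj_act_def act_vec_add image_image)
qed (use assms regular_map_proj_act in auto)

lemma hypersurface_proj_act:
  assumes "2 \<le> d" "d \<le> n" "t \<in> carrier_vec (n - 1)" "p \<in> hypersurface n (log_poly n d)"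
  shows "proj_act n d t p \<in> hypersurface n (log_poly n d)"
  using assms proj_act_in_proj_space[OF assms(1-3)]
  by (auto simp: hypersurface_def proj_act_def eval_form_act_vec)

definition origin :: "nat \<Rightarrow> 'a::field_char_0 vec" where
  "origin n = vec (Suc n) base"

lemma dim_origin [simp]: "dim_vec (origin n) = Suc n"
  by (simp add: origin_def)

lemma origin_index [simp]: "i \<le> n \<Longrightarrow> origin n $ i = base i"
  by (simp add: origin_def)

lemma act_origin:
  assumes "2 \<le> d" "d \<le> n" "k \<le> n"
  shows "act n d t (($) (origin n)) k = act n d t base k"
  by (rule act_cong) (use assms in \<open>auto simp: origin_def\<close>)

lemma origin_nonzero: "origin n \<in> carrier_vec (Suc n)" "origin n \<noteq> 0\<^sub>v (Suc n)"
proof -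
  show "origin n \<in> carrier_vec (Suc n)"
    by (simp add: origin_def)
  have "origin n $ 0 \<noteq> 0\<^sub>v (Suc n) $ 0"
    by (simp add: origin_def)
  then show "origin n \<noteq> 0\<^sub>v (Suc n)" by metis
qed

text \<open>Homogeneity of the form as a function, which makes its vanishing a property of points of
  projective space.\<close>

lemma eval_form_smult:
  assumes "is_form n e f" "v \<in> carrier_vec (Suc n)"
  shows "eval_form f (c \<cdot>\<^sub>v v) = c ^ e * eval_form f v"
  unfolding eval_form_def eval_mpoly_def sum_distrib_left
proof (rule sum.cong)
  fix \<mu> assume \<mu>: "\<mu> \<in> Poly_Mapping.keys f"
  then have keys: "Poly_Mapping.keys \<mu> \<subseteq> {..n}" and deg: "(\<Sum>i\<le>n. Poly_Mapping.lookup \<mu> i) = e"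
    using assms(1) by (auto simp: is_form_def vars_def)
  have "(\<Prod>i\<in>Poly_Mapping.keys \<mu>. (c \<cdot>\<^sub>v v) $ i ^ Poly_Mapping.lookup \<mu> i) =
      (\<Prod>i\<le>n. (c * v $ i) ^ Poly_Mapping.lookup \<mu> i)"
    using assms(2) by (subst monomial_value_superset[OF _ keys]) (auto intro!: prod.cong)
  also have "\<dots> = c ^ e * (\<Prod>i\<le>n. v $ i ^ Poly_Mapping.lookup \<mu> i)"
    by (simp add: power_mult_distrib prod.distrib power_sum[symmetric] deg)
  also have "(\<Prod>i\<le>n. v $ i ^ Poly_Mapping.lookup \<mu> i) =
      (\<Prod>i\<in>Poly_Mapping.keys \<mu>. v $ i ^ Poly_Mapping.lookup \<mu> i)"
    by (rule monomial_value_superset[OF _ keys, symmetric]) simp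
  finally show "Poly_Mapping.lookup f \<mu> * (\<Prod>i\<in>Poly_Mapping.keys \<mu>. (c \<cdot>\<^sub>v v) $ i ^ Poly_Mapping.lookup \<mu> i) =
      c ^ e * (Poly_Mapping.lookup f \<mu> * (\<Prod>i\<in>Poly_Mapping.keys \<mu>. v $ i ^ Poly_Mapping.lookup \<mu> i))"
    by (simp add: mult_ac)
qed simp

lemma proj_point_in_hypersurface:
  assumes "is_form n e f" "v \<in> carrier_vec (Suc n)" "v \<noteq> 0\<^sub>v (Suc n)" "eval_form f v = 0"
  shows "proj_point v \<in> hypersurface n f"
  using assms eval_form_smult[OF assms(1,2)]
  by (auto simp: hypersurface_def proj_space_def proj_point_def)

lemma origin_in_hypersurface:
  assumes "2 \<le> d" "d \<le> n"
  shows "proj_point (origin n) \<in> hypersurface n (log_poly n d)"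
proof (rule proj_point_in_hypersurface[OF is_form_log_poly[OF assms] origin_nonzero])
  have "log_form n d (($) (origin n)) = log_form n d base"
    by (rule log_form_cong) (use assms in \<open>auto simp: origin_def\<close>)
  then show "eval_form (log_poly n d) (origin n) = 0"
    by (simp add: eval_form_def eval_log_poly log_form_base assms)
qed

lemma effective_proj_act:
  assumes "2 \<le> d" "d \<le> n"
  shows "effective_action (n - 1) (hypersurface n (log_poly n d))
    (proj_act n d :: 'a::field_char_0 vec \<Rightarrow> _)"
  unfolding effective_action_def
proof (intro ballI impI)
  fix t :: "'a vec"
  assume t: "t \<in> carrier_vec (n - 1)"
    and fixed: "\<forall>p\<in>hypersurface n (log_poly n d). proj_act n d t p = p"
  have "proj_point (act_vec n d t (origin n)) = proj_point (origin n)"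
    using fixed origin_in_hypersurface[OF assms] image_act_vec_proj_point[OF assms origin_nonzero(1)]
    unfolding proj_act_def by metis
  then have "act_vec n d t (origin n) \<in> proj_point (origin n)"
    using proj_point_self by metis
  then obtain c where c: "act_vec n d t (origin n) = c \<cdot>\<^sub>v origin n"
    by (auto simp: proj_point_def)
  have "act n d (($) t) base k = 0" if "1 \<le> k" "k \<le> n" for k
    using arg_cong[OF c, of "\<lambda>v. v $ k"] that act_origin[OF assms that(2), of "($) t"] by simp
  then have "t $ i = 0" if "i < n - 1" for i
    using act_base_eq_base[OF assms(1) _ that assms(2)] by blast
  then show "t = 0\<^sub>v (n - 1)"
    using t by (intro eq_vecI) auto
qed

text \<open>The orbit of the unit consists of the points of the hypersurface with $z_0 \<noteq> 0$; after
  scaling $z_0$ to one this is the description of the orbit of the unit in $A$.\<close>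

lemma orbit_origin:
  fixes n d :: nat
  assumes "2 \<le> d" "d \<le> n"
  shows "(\<lambda>t. proj_act n d t (proj_point (origin n :: 'a::field_char_0 vec))) ` carrier_vec (n - 1) =
    {p \<in> proj_space n. \<forall>v\<in>p. eval_form (var 0) v \<noteq> 0} \<inter> hypersurface n (log_poly n d)" (is "?O = ?U \<inter> ?X")
proof
  show "?O \<subseteq> ?U \<inter> ?X"
  proof
    fix p assume "p \<in> ?O"
    then obtain t where t: "t \<in> carrier_vec (n - 1)" and p: "p = proj_act n d t (proj_point (origin n))"
      by blast
    have X: "p \<in> ?X"
      unfolding p by (rule hypersurface_proj_act[OF assms t origin_in_hypersurface[OF assms]])
    have p': "p = proj_point (act_vec n d t (origin n))"
      by (simp add: p proj_act_def image_act_vec_proj_point[OF assms origin_nonzero(1)])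
    have "act_vec n d t (origin n) $ 0 = (1 :: 'a)"
      using assms(1) by (simp add: act_0_coord)
    then have "v $ 0 \<noteq> 0" if "v \<in> p" for v
      using that act_vec_carrier[of n d t "origin n"] by (auto simp: p' proj_point_def)
    then show "p \<in> ?U \<inter> ?X"
      using X by (auto simp: hypersurface_def eval_form_def eval_mpoly_var)
  qed
  show "?U \<inter> ?X \<subseteq> ?O"
  proof
    fix p assume p: "p \<in> ?U \<inter> ?X"
    then obtain v where v: "v \<in> carrier_vec (Suc n)" "p = proj_point v"
      by (auto simp: proj_space_def)
    have v0: "v $ 0 \<noteq> 0"
      using p v proj_point_self[of v] by (auto simp: eval_form_def eval_mpoly_var)
    define w where "w = inverse (v $ 0) \<cdot>\<^sub>v v"
    have w: "w \<in> carrier_vec (Suc n)" "w $ 0 = 1" "p = proj_point w"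
      using v v0 by (simp_all add: w_def proj_point_smult)
    have "log_form n d (($) w) = 0"
      using p w(3) proj_point_self[of w] by (auto simp: hypersurface_def eval_form_def eval_log_poly)
    then obtain s where s: "\<And>k. k \<le> n \<Longrightarrow> act n d s base k = w $ k"
      using orbit_base[OF assms, of "($) w"] w(2) by blast
    have "act_vec n d (vec (n - 1) s) (origin n) = w"
    proof (rule eq_vecI)
      fix i assume "i < dim_vec w"
      then have i: "i \<le> n" using w(1) by simp
      have "act n d (($) (vec (n - 1) s)) (($) (origin n)) i = act n d s base i"
        by (rule act_cong) (use assms i in \<open>auto simp: origin_def\<close>)
      then show "act_vec n d (vec (n - 1) s) (origin n) $ i = w $ i"
        using i s by simp
    qed (use w(1) in \<open>simp add: act_vec_def\<close>)
    then have "p = proj_act n d (vec (n - 1) s) (proj_point (origin n))"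
      by (simp add: proj_act_def image_act_vec_proj_point[OF assms origin_nonzero(1)] w(3))
    then show "p \<in> ?O" by auto
  qed
qed

lemma induced_additive_action_log_poly:
  assumes "2 \<le> d" "d \<le> n"
  shows "induced_additive_action (n - 1) n (hypersurface n (log_poly n d :: (nat, 'a::field_char_0) mpoly))
    (proj_act n d)"
proof -
  let ?X = "hypersurface n (log_poly n d :: (nat, 'a) mpoly)"
  have "?X \<subseteq> proj_space n"
    by (auto simp: hypersurface_def)
  then have "regular_action (n - 1) n ?X (proj_act n d)"
    by (rule regular_action_proj_act[OF assms]) (rule hypersurface_proj_act[OF assms])
  moreover have "regular_action (n - 1) n (proj_space n) (proj_act n d :: 'a vec \<Rightarrow> _)"
    by (rule regular_action_proj_act[OF assms subset_refl]) (rule proj_act_in_proj_space[OF assms])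
  moreover have "openin (subtopology (zariski_proj n) ?X)
      ((\<lambda>t. proj_act n d t (proj_point (origin n))) ` carrier_vec (n - 1))"
  proof -
    have "is_form n 1 (var 0 :: (nat, 'a) mpoly)"
      using homogeneous_on_var[of "{..n}" 0 "{..n}"] by (simp add: is_form_homogeneous)
    then have "openin (zariski_proj n) {p \<in> proj_space n. \<forall>v\<in>p. eval_form (var 0 :: (nat, 'a) mpoly) v \<noteq> 0}"
      unfolding zariski_proj_def by (intro topology_generated_by_Basis) blast
    then show ?thesis
      unfolding orbit_origin[OF assms] by (rule openin_subtopology_Int)
  qed
  ultimately show ?thesis
    unfolding induced_additive_action_def additive_action_def
    using effective_proj_act[OF assms] origin_in_hypersurface[OF assms] by blast
qed

theorem proposition3p1:
  fixes n d :: nat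
  assumes "2 \<le> d" and "d \<le> n"
  shows "\<exists>f :: (nat, 'a::{alg_closed_field, field_char_0}) mpoly.
           hypersurface_eq n d f \<and> non_degenerate n f \<and>
           admits_induced_additive_action n (hypersurface n f)"
  unfolding hypersurface_eq_def admits_induced_additive_action_def
  using is_form_log_poly[OF assms] irreducible_log_poly[OF assms] non_degenerate_log_poly[OF assms]
    induced_additive_action_log_poly[OF assms]
  by blast

end
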